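(* Let $\mathcal{F}$ be a family of graphs each of which is critical and $1$-unique, and let $\mathcal{S}_k$ ($k\ge 2$) be the families of graphs constructed inductively from $\mathcal{F}$ (as defined in the context). Then for every $k\ge 2$, every graph in $\mathcal{S}_k$ is $k$-critical and $1$-unique. Furthermore, if every graph $F\in\mathcal{F}$ satisfies $|V(F)|\le 2^{\mathrm{td}(F)-1}$, then for every $k\ge 2$ every graph $G\in\mathcal{S}_k$ satisfies $|V(G)|\le 2^{k-1}$.
   Context: Graphs are finite and simple. A $k$-ranking of a graph $G$ is a labeling of $V(G)$ with values from $\{1,\dots,k\}$ such that every path joining two distinct vertices with the same label contains a vertex having a larger label. The tree-depth $\mathrm{td}(G)$ is the smallest $k$ for which $G$ has a $k$-ranking (the graph with no vertices has tree-depth $0$). A ranking of $G$ is optimal if it is a $\mathrm{td}(G)$-ranking. A graph is critical if every proper minor of it has smaller tree-depth, and $k$-critical if it is critical and has tree-depth $k$. A graph $G$ is $1$-unique if for every vertex $v$ of $G$ there is an optimal ranking of $G$ in which $v$ is the only vertex receiving label $1$. Adjoining construction: given a graph $H$ with vertices $v_1,\dots,v_q$ (where $q=|V(H)|$) and graphs $L_1,\dots,L_q$ (taken vertex-disjoint from each other and from $H$), choose a vertex $w_i\in V(L_i)$ for each $i$ and form a graph $G$ from the disjoint union of $H,L_1,\dots,L_q$ by identifying $v_i$ with $w_i$ for every $i\in\{1,\dots,q\}$. Families $\mathcal{S}_k$: given $\mathcal{F}$, let $\mathcal{S}_2=\{K_2\}$, and for $k>2$ let $\mathcal{S}_k$ consist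 of all $k$-critical graphs in $\mathcal{F}$ together with all graphs $G$ obtained by the adjoining construction (with any choice of the vertices $w_i$) with $H\in\mathcal{S}_s$ and all $L_i\in\mathcal{S}_{r+1}$, for integers $r\ge 1$ and $s\ge 2$ with $r+s=k$. *)

theory Defs
  imports "Graph_Theory.Graph_Theory"
begin

text \<open>A finite simple graph is a \<^locale>\<open>pair_graph\<close>: finite, loop-free and symmetric, so an
  undirected edge is a pair of opposite arcs.\<close>

definition is_ranking :: "nat \<Rightarrow> 'a pair_pre_digraph \<Rightarrow> ('a \<Rightarrow> nat) \<Rightarrow> bool" where
  "is_ranking k G f \<longleftrightarrow>
     (\<forall>v\<in>pverts G. f v \<in> {1..k}) \<and>
     (\<forall>p. vpath p (with_proj G) \<and> hd p \<noteq> last p \<and> f (hd p) = f (last p)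
        \<longrightarrow> (\<exists>x\<in>set p. f x > f (hd p)))"

definition tree_depth :: "'a pair_pre_digraph \<Rightarrow> nat" where
  "tree_depth G = (LEAST k. \<exists>f. is_ranking k G f)"

definition optimal_ranking :: "'a pair_pre_digraph \<Rightarrow> ('a \<Rightarrow> nat) \<Rightarrow> bool" where
  "optimal_ranking G f \<longleftrightarrow> is_ranking (tree_depth G) G f"

definition delete_vertex :: "'a pair_pre_digraph \<Rightarrow> 'a \<Rightarrow> 'a pair_pre_digraph" where
  "delete_vertex G v =
     \<lparr> pverts = pverts G - {v}, parcs = {(x, y) \<in> parcs G. x \<noteq> v \<and> y \<noteq> v} \<rparr>"

definition delete_edge :: "'a pair_pre_digraph \<Rightarrow> 'a \<Rightarrow> 'a \<Rightarrow> 'a pair_pre_digraph" where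
  "delete_edge G u v = \<lparr> pverts = pverts G, parcs = parcs G - {(u, v), (v, u)} \<rparr>"

text \<open>The merged vertex of a contracted edge \<open>uv\<close> is called \<open>u\<close>; the loop and
  the parallel edges that arise are suppressed.\<close>

definition contract_edge :: "'a pair_pre_digraph \<Rightarrow> 'a \<Rightarrow> 'a \<Rightarrow> 'a pair_pre_digraph" where
  "contract_edge G u v =
     (let c = (\<lambda>x. if x = v then u else x)
      in \<lparr> pverts = c ` pverts G, parcs = map_prod c c ` parcs G - Id \<rparr>)"

inductive minor_step :: "'a pair_pre_digraph \<Rightarrow> 'a pair_pre_digraph \<Rightarrow> bool" where
  del_vertex: "v \<in> pverts G \<Longrightarrow> minor_step G (delete_vertex G v)"
| del_edge: "(u, v) \<in> parcs G \<Longrightarrow> minor_step G (delete_edge G u v)"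
| contr_edge: "(u, v) \<in> parcs G \<Longrightarrow> minor_step G (contract_edge G u v)"

definition proper_minor :: "'a pair_pre_digraph \<Rightarrow> 'a pair_pre_digraph \<Rightarrow> bool" where
  "proper_minor M G \<longleftrightarrow> minor_step\<^sup>+\<^sup>+ G M"

definition critical :: "'a pair_pre_digraph \<Rightarrow> bool" where
  "critical G \<longleftrightarrow> (\<forall>M. proper_minor M G \<longrightarrow> tree_depth M < tree_depth G)"

definition k_critical :: "nat \<Rightarrow> 'a pair_pre_digraph \<Rightarrow> bool" where
  "k_critical k G \<longleftrightarrow> critical G \<and> tree_depth G = k"

definition one_unique :: "'a pair_pre_digraph \<Rightarrow> bool" where
  "one_unique G \<longleftrightarrow>
     (\<forall>v\<in>pverts G. \<exists>f. optimal_ranking G f \<and> {u \<in> pverts G. f u = 1} = {v})"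

text \<open>Pairing the vertices of \<open>L v\<close> with \<open>v\<close> makes the graphs \<open>L v\<close> disjoint. The vertex
  \<open>v\<close> of \<open>H\<close>, identified with the vertex \<open>w v\<close> of \<open>L v\<close>, becomes \<open>(v, w v)\<close>.\<close>

definition adjoin ::
    "'a pair_pre_digraph \<Rightarrow> ('a \<Rightarrow> 'b pair_pre_digraph) \<Rightarrow> ('a \<Rightarrow> 'b) \<Rightarrow> ('a \<times> 'b) pair_pre_digraph"
where
  "adjoin H L w =
     \<lparr> pverts = (SIGMA v : pverts H. pverts (L v)),
       parcs = {((u, w u), (v, w v)) | u v. (u, v) \<in> parcs H} \<union>
               {((v, x), (v, y)) | v x y. v \<in> pverts H \<and> (x, y) \<in> parcs (L v)} \<rparr>"

text \<open>\<open>in_S \<F> k G\<close> states that \<open>G\<close> belongs to \<open>\<S>\<^sub>k\<close>. Membership is up to isomorphism, which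
  also brings \<^const>\<open>adjoin\<close> back to the vertex type of its ingredients.\<close>

inductive in_S :: "'a pair_pre_digraph set \<Rightarrow> nat \<Rightarrow> 'a pair_pre_digraph \<Rightarrow> bool"
  for \<F> :: "'a pair_pre_digraph set" where
  K2: "K\<^bsub>2\<^esub> (with_proj G) \<Longrightarrow> in_S \<F> 2 G"
| family: "k > 2 \<Longrightarrow> F \<in> \<F> \<Longrightarrow> k_critical k F \<Longrightarrow> digraph_iso (with_proj F) (with_proj G)
    \<Longrightarrow> in_S \<F> k G"
| adjoining: "r \<ge> 1 \<Longrightarrow> s \<ge> 2 \<Longrightarrow> r + s = k \<Longrightarrow> in_S \<F> s H
    \<Longrightarrow> (\<And>v. v \<in> pverts H \<Longrightarrow> in_S \<F> (r + 1) (L v))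
    \<Longrightarrow> (\<And>v. v \<in> pverts H \<Longrightarrow> w v \<in> pverts (L v))
    \<Longrightarrow> digraph_iso (with_proj (adjoin H L w)) (with_proj G)
    \<Longrightarrow> in_S \<F> k G"

end

theory Submission
  imports Defs
begin

text \<open>Let \<open>G\<close> be obtained by adjoining graphs \<open>L v\<close> of tree-depth \<open>r + 1\<close> to a graph \<open>H\<close> of
  tree-depth \<open>s\<close>, all of them critical and 1-unique. By induction over the construction it
  suffices that \<open>G\<close> is \<open>(r + s)\<close>-critical and 1-unique, and that \<open>card (pverts G)\<close>, the sum of the
  \<open>card (pverts (L v))\<close>, is at most \<open>2 ^ (s - 1) * 2 ^ r\<close>.

  Tree-depth. Critical graphs are connected (\<open>critical_connected\<close>), so the largest labels on the
  copies of the \<open>L v\<close> in a ranking of \<open>G\<close> rank \<open>H\<close>. Each is at least \<open>r + 1\<close>, whence at least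
  \<open>r + s\<close> labels occur (\<open>tree_depth_adjoin_ge\<close>).

  1-uniqueness. Given a vertex \<open>x\<close> of \<open>L v\<close>, rank \<open>L v\<close> with its only \<open>1\<close> at \<open>x\<close>, the other
  \<open>L u\<close> with their only \<open>1\<close> at the attaching vertex, and \<open>H\<close> with its only \<open>1\<close> at \<open>v\<close>. Use the
  rankings of the \<open>L u\<close> off the attaching vertices and on all of \<open>L v\<close>, and put the labels
  \<open>2..s\<close> of the vertices of \<open>H\<close> other than \<open>v\<close> on top. Only \<open>x\<close> keeps label \<open>1\<close>, and \<open>r + s\<close>
  labels are used, which also is the upper bound for the tree-depth
  (\<open>ranking_with_unique_label_one\<close>).

  Criticality. It is enough to consider a single deletion or contraction (\<open>critical_iff\<close>). Each
  \<open>L u\<close> without its attaching vertex has a ranking by \<open>1..r\<close>. If the step happens in \<open>H\<close>, the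
  vertices of the reduced \<open>H\<close> use \<open>s - 1\<close> further labels (\<open>base_ranking\<close>). If it happens
  inside \<open>L v\<close>, then the whole remainder of \<open>L v\<close> is ranked by \<open>1..r\<close>, and the remaining vertices of \<open>H\<close>
  need only \<open>s - 1\<close> further labels in a ranking of \<open>H\<close> whose only \<open>1\<close> is at \<open>v\<close> (\<open>piece_ranking\<close>).

  Rankings are handled through reachability along vertices with bounded labels
  (\<open>is_ranking_iff\<close>); this turns each of the combined labellings into an instance of one
  gluing lemma, \<open>separated_glue\<close>.\<close>

section \<open>Rankings as a reachability condition\<close>

text \<open>\<open>low_arcs G f j\<close> is the part of \<open>G\<close> on the labels up to \<open>j\<close>. A labelling is \<open>separated\<close> when
  each component of that part contains label \<open>j\<close> at most once; the range of the labels is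
  left open so that labels can be shifted freely.\<close>

definition low_arcs :: "'a pair_pre_digraph \<Rightarrow> ('a \<Rightarrow> nat) \<Rightarrow> nat \<Rightarrow> 'a rel" where
  "low_arcs G f j = {(x, y) \<in> parcs G. f x \<le> j \<and> f y \<le> j}"

definition separated :: "'a pair_pre_digraph \<Rightarrow> ('a \<Rightarrow> nat) \<Rightarrow> bool" where
  "separated G f \<longleftrightarrow>
     (\<forall>x\<in>pverts G. \<forall>y\<in>pverts G. f x = f y \<and> (x, y) \<in> (low_arcs G f (f x))\<^sup>* \<longrightarrow> x = y)"

lemma low_arcs_iff [simp]:
  "(x, y) \<in> low_arcs G f j \<longleftrightarrow> (x, y) \<in> parcs G \<and> f x \<le> j \<and> f y \<le> j"
  by (simp add: low_arcs_def)

lemma separatedD: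
  assumes "separated G f" "x \<in> pverts G" "y \<in> pverts G" "f x = f y"
    and "(x, y) \<in> (low_arcs G f (f x))\<^sup>*"
  shows "x = y"
  using assms by (auto simp: separated_def)

lemma separatedI:
  assumes "\<And>x y. x \<in> pverts G \<Longrightarrow> y \<in> pverts G \<Longrightarrow> f x = f y \<Longrightarrow>
    (x, y) \<in> (low_arcs G f (f x))\<^sup>* \<Longrightarrow> x = y"
  shows "separated G f"
  using assms by (auto simp: separated_def)

lemma pair_graph_iff:
  "pair_graph G \<longleftrightarrow> finite (pverts G) \<and> (\<forall>x y. (x, y) \<in> parcs G \<longrightarrow>
     x \<in> pverts G \<and> y \<in> pverts G \<and> (y, x) \<in> parcs G \<and> x \<noteq> y)"
proof
  assume "pair_graph G"
  then interpret pair_graph G .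
  show "finite (pverts G) \<and> (\<forall>x y. (x, y) \<in> parcs G \<longrightarrow>
     x \<in> pverts G \<and> y \<in> pverts G \<and> (y, x) \<in> parcs G \<and> x \<noteq> y)"
    using pair_finite_verts in_arcsD1 in_arcsD2 pair_no_loops pair_sym_arcs
    by (fastforce simp: symmetric_def sym_def)
next
  assume *: "finite (pverts G) \<and> (\<forall>x y. (x, y) \<in> parcs G \<longrightarrow>
     x \<in> pverts G \<and> y \<in> pverts G \<and> (y, x) \<in> parcs G \<and> x \<noteq> y)"
  then have "parcs G \<subseteq> pverts G \<times> pverts G" by auto
  then have "finite (parcs G)" using * finite_subset by blast
  moreover have "fst e \<in> pverts G \<and> snd e \<in> pverts G \<and> fst e \<noteq> snd e" if "e \<in> parcs G" for e
    using * that by (cases e) auto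
  moreover have "symmetric (with_proj G)"
    using * unfolding symmetric_def by (intro symI) simp
  ultimately show "pair_graph G"
    using * by unfold_locales blast+
qed

lemmas pair_graphI = pair_graph_iff[THEN iffD2, OF conjI, rule_format]

lemma pair_graphD:
  assumes "pair_graph G"
  shows "finite (pverts G)"
    and "(x, y) \<in> parcs G \<Longrightarrow> x \<in> pverts G"
    and "(x, y) \<in> parcs G \<Longrightarrow> y \<in> pverts G"
    and "(x, y) \<in> parcs G \<Longrightarrow> (y, x) \<in> parcs G"
    and "(x, y) \<in> parcs G \<Longrightarrow> x \<noteq> y"
  using assms by (auto simp: pair_graph_iff)

lemma low_walk_if_reachable:
  assumes "(x, y) \<in> (low_arcs G f j)\<^sup>*" "pair_graph G" "y \<in> pverts G" "f y \<le> j"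
  shows "\<exists>p. vwalk p (with_proj G) \<and> hd p = x \<and> last p = y \<and> (\<forall>z\<in>set p. f z \<le> j)"
  using assms(1)
proof (induction rule: converse_rtrancl_induct)
  case base
  show ?case using assms by (intro exI[of _ "[y]"]) (auto simp: vwalk_def)
next
  case (step x z)
  then obtain p where p: "vwalk p (with_proj G)" "hd p = z" "last p = y" "\<forall>z\<in>set p. f z \<le> j"
    by blast
  have "vwalk (x # p) (with_proj G)"
    using step p pair_graphD(2)[OF assms(2)] by (intro vwalk_consI) auto
  moreover have "p \<noteq> []" using p by (auto simp: vwalk_def)
  ultimately show ?case using step p by (intro exI[of _ "x # p"]) auto
qed

lemma reachable_if_low_walk:
  assumes "vwalk p (with_proj G)" "\<forall>z\<in>set p. f z \<le> j"
  shows "(hd p, last p) \<in> (low_arcs G f j)\<^sup>*"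
  using assms
proof (induction rule: vwalk_induct)
  case (Cons u v es)
  then have "(u, v) \<in> low_arcs G f j" by auto
  with Cons show ?case by (auto intro: converse_rtrancl_into_rtrancl)
qed simp

text \<open>A walk all of whose labels are at most \<open>j\<close> contains a path with the same ends, so the
  path condition may be tested by reachability, which survives gluing and contraction.\<close>

lemma is_ranking_iff:
  assumes "pair_graph G"
  shows "is_ranking k G f \<longleftrightarrow> (\<forall>v\<in>pverts G. f v \<in> {1..k}) \<and> separated G f"
proof -
  have "(\<forall>p. vpath p (with_proj G) \<and> hd p \<noteq> last p \<and> f (hd p) = f (last p)
        \<longrightarrow> (\<exists>x\<in>set p. f x > f (hd p))) \<longleftrightarrow> separated G f" (is "?P \<longleftrightarrow> _")
  proof
    assume ?P
    show "separated G f"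
    proof (rule separatedI, rule ccontr)
      fix x y assume xy: "y \<in> pverts G" "f x = f y"
        "(x, y) \<in> (low_arcs G f (f x))\<^sup>*" "x \<noteq> y"
      then obtain p where p: "vwalk p (with_proj G)" "hd p = x" "last p = y"
        "\<forall>z\<in>set p. f z \<le> f x"
        using low_walk_if_reachable[OF xy(3) assms xy(1)] by auto
      let ?q = "vwalk_to_vpath p"
      have q: "vpath ?q (with_proj G)" "hd ?q = x" "last ?q = y" "\<forall>z\<in>set ?q. f z \<le> f x"
        using p vwalk_to_vpath_subset[of _ p]
        by (simp_all add: vwalk_to_vpath_hd vwalk_to_vpath_last vwalk_to_vpath_vpath)
      have "\<exists>z\<in>set ?q. f (hd ?q) < f z"
        using \<open>?P\<close>[rule_format, of ?q] q(1-3) xy(2,4) by simp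
      with q(2,4) show False by fastforce
    qed
  next
    assume sep: "separated G f"
    show ?P
    proof (intro allI impI, rule ccontr)
      fix p assume p: "vpath p (with_proj G) \<and> hd p \<noteq> last p \<and> f (hd p) = f (last p)"
        and "\<not> (\<exists>x\<in>set p. f (hd p) < f x)"
      then have w: "vwalk p (with_proj G)" and "\<forall>z\<in>set p. f z \<le> f (hd p)"
        by (auto simp: vpath_def)
      then have "(hd p, last p) \<in> (low_arcs G f (f (hd p)))\<^sup>*"
        by (rule reachable_if_low_walk)
      moreover have "hd p \<in> pverts G" "last p \<in> pverts G"
        using w by (auto simp: vwalk_def subset_iff)
      ultimately show False using separatedD[OF sep] p by blast
    qed
  qed
  then show ?thesis by (simp add: is_ranking_def)
qed

text \<open>A model of a minor \<open>M\<close> in \<open>G\<close>: the vertex \<open>x\<close> of \<open>M\<close> is spread over a connected branch set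
  \<open>B x\<close> of \<open>G\<close>. The largest label of a branch set, attained at \<open>a x\<close>, ranks \<open>M\<close>, since a
  walk of \<open>M\<close> lifts to one through the branch sets that meets no larger label. This gives
  both the monotonicity of tree-depth under minors and the lower bound for an adjunction.\<close>

lemma separated_branch:
  assumes sep: "separated G f"
    and top: "\<And>x. x \<in> pverts M \<Longrightarrow> a x \<in> B x"
      "\<And>x b. x \<in> pverts M \<Longrightarrow> b \<in> B x \<Longrightarrow> b \<in> pverts G \<and> f b \<le> f (a x)"
    and disj: "\<And>x y b. x \<in> pverts M \<Longrightarrow> y \<in> pverts M \<Longrightarrow> b \<in> B x \<Longrightarrow> b \<in> B y \<Longrightarrow> x = y"
    and conn: "\<And>x b c. x \<in> pverts M \<Longrightarrow> b \<in> B x \<Longrightarrow> c \<in> B x \<Longrightarrow>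
      (b, c) \<in> (Restr (parcs G) (B x))\<^sup>*"
    and arc: "\<And>x y. (x, y) \<in> parcs M \<Longrightarrow>
      x \<in> pverts M \<and> y \<in> pverts M \<and> (\<exists>b\<in>B x. \<exists>c\<in>B y. (b, c) \<in> parcs G)"
  shows "separated M (f \<circ> a)"
proof (rule separatedI)
  fix x y assume xy: "x \<in> pverts M" "y \<in> pverts M" "(f \<circ> a) x = (f \<circ> a) y"
    "(x, y) \<in> (low_arcs M (f \<circ> a) ((f \<circ> a) x))\<^sup>*"
  define j where "j = f (a x)"
  have inside: "(b, c) \<in> (low_arcs G f j)\<^sup>*"
    if "z \<in> pverts M" "f (a z) \<le> j" "b \<in> B z" "c \<in> B z" for z b c
  proof -
    have "Restr (parcs G) (B z) \<subseteq> low_arcs G f j"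
      using that top(2) by (fastforce simp: low_arcs_def)
    then show ?thesis using conn[OF that(1,3,4)] rtrancl_mono by blast
  qed
  have "(x, y) \<in> (low_arcs M (f \<circ> a) j)\<^sup>*" using xy by (simp add: j_def)
  then have "(a x, a y) \<in> (low_arcs G f j)\<^sup>*"
  proof (induction rule: rtrancl_induct)
    case (step y z)
    then have yz: "y \<in> pverts M" "z \<in> pverts M" "f (a y) \<le> j" "f (a z) \<le> j"
      using arc by auto
    obtain b c where bc: "b \<in> B y" "c \<in> B z" "(b, c) \<in> parcs G"
      using step.hyps(2) arc[of y z] by auto
    then have "(b, c) \<in> low_arcs G f j"
      using yz top(2) by (fastforce simp: low_arcs_def)
    moreover have "(a y, b) \<in> (low_arcs G f j)\<^sup>*" "(c, a z) \<in> (low_arcs G f j)\<^sup>*"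
      using inside yz bc top(1) by auto
    ultimately show ?case using step.IH by (meson rtrancl.rtrancl_into_rtrancl rtrancl_trans)
  qed simp
  then have "a x = a y" using separatedD[OF sep] xy top by (auto simp: j_def)
  then show "x = y" using disj[of x y "a x"] xy(1,2) top(1)[of x] top(1)[of y] by simp
qed

lemma separated_pullback:
  assumes "separated G f" "inj_on a (pverts M)" "a ` pverts M \<subseteq> pverts G"
    and "\<And>x y. (x, y) \<in> parcs M \<Longrightarrow> x \<in> pverts M \<and> y \<in> pverts M \<and> (a x, a y) \<in> parcs G"
  shows "separated M (f \<circ> a)"
  by (rule separated_branch[OF assms(1), where B = "\<lambda>x. {a x}"])
    (use assms in \<open>auto dest: inj_onD\<close>)

lemma separated_transfer:
  assumes "separated G f" "strict_mono_on (f ` pverts G) h" "pair_graph G"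
  shows "separated G (h \<circ> f)"
proof (rule separatedI)
  fix x y assume xy: "x \<in> pverts G" "y \<in> pverts G" "(h \<circ> f) x = (h \<circ> f) y"
    "(x, y) \<in> (low_arcs G (h \<circ> f) ((h \<circ> f) x))\<^sup>*"
  then have fxy: "f x = f y"
    using strict_mono_on_eqD[OF assms(2), of "f x" "f y"] by simp
  have le: "f z \<le> f x" if "z \<in> pverts G" "h (f z) \<le> h (f x)" for z
    using that xy(1) strict_mono_onD[OF assms(2), of "f x" "f z"] by fastforce
  have "low_arcs G (h \<circ> f) ((h \<circ> f) x) \<subseteq> low_arcs G f (f x)"
    using le by (auto simp: low_arcs_def dest: pair_graphD(2,3)[OF assms(3)])
  then have "(x, y) \<in> (low_arcs G f (f x))\<^sup>*" using xy rtrancl_mono by blast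
  then show "x = y" using separatedD[OF assms(1)] xy fxy by blast
qed

section \<open>Tree-depth, minors and isomorphism\<close>

lemma tree_depth_le: "is_ranking k G f \<Longrightarrow> tree_depth G \<le> k"
  unfolding tree_depth_def by (rule Least_le) blast

lemma ex_optimal_ranking:
  assumes "pair_graph G"
  obtains f where "is_ranking (tree_depth G) G f"
proof -
  have "finite (pverts G)" using assms by (simp add: pair_graph_iff)
  then obtain h where h: "bij_betw h (pverts G) {0..<card (pverts G)}"
    using ex_bij_betw_finite_nat by blast
  then have "separated G (Suc \<circ> h)"
    by (auto simp: separated_def bij_betw_def inj_on_def)
  moreover have "\<forall>v\<in>pverts G. (Suc \<circ> h) v \<in> {1..card (pverts G)}"
    using h by (auto simp: bij_betw_def Suc_le_eq)
  ultimately have "\<exists>f. is_ranking (card (pverts G)) G f"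
    using is_ranking_iff[OF assms] by blast
  then have "\<exists>f. is_ranking (tree_depth G) G f"
    unfolding tree_depth_def by (rule LeastI)
  then show ?thesis using that by blast
qed

lemma is_ranking_mono: "is_ranking k G f \<Longrightarrow> k \<le> l \<Longrightarrow> is_ranking l G f"
  by (fastforce simp: is_ranking_def)

lemma ex_ranking_iff:
  assumes "pair_graph G"
  shows "(\<exists>f. is_ranking k G f) \<longleftrightarrow> tree_depth G \<le> k"
  using tree_depth_le is_ranking_mono ex_optimal_ranking[OF assms] by metis

lemma pair_graph_delete_vertex: "pair_graph G \<Longrightarrow> pair_graph (delete_vertex G v)"
  by (rule pair_graphI) (auto simp: delete_vertex_def dest: pair_graphD)

lemma pair_graph_delete_edge: "pair_graph G \<Longrightarrow> pair_graph (delete_edge G u v)"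
  by (rule pair_graphI) (auto simp: delete_edge_def dest: pair_graphD)

lemma pverts_contract_edge:
  assumes "pair_graph G" "(u, v) \<in> parcs G"
  shows "pverts (contract_edge G u v) = pverts G - {v}"
  using pair_graphD(2,5)[OF assms] by (auto simp: contract_edge_def Let_def image_iff)

lemma in_map_prod_image_iff:
  "(x, y) \<in> map_prod c d ` E \<longleftrightarrow> (\<exists>a b. (a, b) \<in> E \<and> x = c a \<and> y = d b)"
  by force

lemma parcs_contract_edge:
  "(x, y) \<in> parcs (contract_edge G u v) \<longleftrightarrow> x \<noteq> y \<and> (\<exists>a b. (a, b) \<in> parcs G \<and>
     x = (if a = v then u else a) \<and> y = (if b = v then u else b))"
  unfolding contract_edge_def Let_def pair_pre_digraph.simps Diff_iff in_map_prod_image_iff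
  by blast

lemma pair_graph_contract_edge:
  assumes G: "pair_graph G" and uv: "(u, v) \<in> parcs G"
  shows "pair_graph (contract_edge G u v)"
proof (rule pair_graphI)
  show "finite (pverts (contract_edge G u v))"
    using pair_graphD(1)[OF G] by (simp add: pverts_contract_edge[OF assms])
  fix x y assume "(x, y) \<in> parcs (contract_edge G u v)"
  then obtain a b where ab: "x \<noteq> y" "(a, b) \<in> parcs G"
     "x = (if a = v then u else a)" "y = (if b = v then u else b)"
    by (auto simp: parcs_contract_edge)
  moreover have "a \<in> pverts G" "b \<in> pverts G" "(b, a) \<in> parcs G" "u \<in> pverts G" "u \<noteq> v"
    using pair_graphD[OF G] uv ab(2) by blast+
  ultimately show "x \<in> pverts (contract_edge G u v) \<and> y \<in> pverts (contract_edge G u v) \<and>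
      (y, x) \<in> parcs (contract_edge G u v) \<and> x \<noteq> y"
    unfolding pverts_contract_edge[OF assms] parcs_contract_edge by auto
qed

lemma pair_graph_minor_step: "minor_step G M \<Longrightarrow> pair_graph G \<Longrightarrow> pair_graph M"
  by (induction rule: minor_step.induct)
    (auto intro: pair_graph_delete_vertex pair_graph_delete_edge pair_graph_contract_edge)

text \<open>The label of each vertex of \<open>M\<close> is copied from a vertex of \<open>G\<close>, so no new labels are needed.\<close>

lemma tree_depth_mono_if_branch:
  assumes "pair_graph G" "pair_graph M"
    and "\<And>f. separated G f \<Longrightarrow> \<exists>a. a ` pverts M \<subseteq> pverts G \<and> separated M (f \<circ> a)"
  shows "tree_depth M \<le> tree_depth G"
proof -
  obtain f where f: "is_ranking (tree_depth G) G f" using ex_optimal_ranking[OF assms(1)] .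
  then obtain a where "a ` pverts M \<subseteq> pverts G" "separated M (f \<circ> a)"
    using assms(3) is_ranking_iff[OF assms(1)] by blast
  with f have "is_ranking (tree_depth G) M (f \<circ> a)"
    by (auto simp: is_ranking_iff[OF assms(1)] is_ranking_iff[OF assms(2)])
  then show ?thesis by (rule tree_depth_le)
qed

definition embeds :: "('a \<Rightarrow> 'b) \<Rightarrow> 'a pair_pre_digraph \<Rightarrow> 'b pair_pre_digraph \<Rightarrow> bool" where
  "embeds a M G \<longleftrightarrow> inj_on a (pverts M) \<and> a ` pverts M \<subseteq> pverts G \<and>
     (\<forall>x y. (x, y) \<in> parcs M \<longrightarrow> (a x, a y) \<in> parcs G)"

lemma tree_depth_mono_if_embeds:
  assumes "pair_graph G" "pair_graph M" "embeds a M G"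
  shows "tree_depth M \<le> tree_depth G"
proof (rule tree_depth_mono_if_branch[OF assms(1,2)])
  fix f assume "separated G f"
  then have "separated M (f \<circ> a)"
    using assms(3) pair_graphD(2,3)[OF assms(2)] unfolding embeds_def
    by (intro separated_pullback) blast+
  then show "\<exists>a. a ` pverts M \<subseteq> pverts G \<and> separated M (f \<circ> a)"
    using assms(3) unfolding embeds_def by blast
qed

lemma tree_depth_contract_edge_le:
  assumes G: "pair_graph G" and uv: "(u, v) \<in> parcs G"
  shows "tree_depth (contract_edge G u v) \<le> tree_depth G"
proof (rule tree_depth_mono_if_branch[OF G pair_graph_contract_edge[OF G uv]])
  fix f assume sep: "separated G f"
  let ?M = "contract_edge G u v"
  have g: "u \<in> pverts G" "v \<in> pverts G" "(v, u) \<in> parcs G"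
    using pair_graphD[OF G] uv by blast+
  define a where "a = (\<lambda>x. if x = u \<and> f u \<le> f v then v else x)"
  define B where "B = (\<lambda>x. if x = u then {u, v} else {x})"
  have V: "pverts ?M = pverts G - {v}" by (rule pverts_contract_edge[OF G uv])
  have "separated ?M (f \<circ> a)"
  proof (rule separated_branch[OF sep, where B = B])
    fix x b c assume "x \<in> pverts ?M" "b \<in> B x" "c \<in> B x"
    then show "(b, c) \<in> (Restr (parcs G) (B x))\<^sup>*"
      using uv g by (auto simp: B_def split: if_splits)
  next
    fix x y assume xy: "(x, y) \<in> parcs ?M"
    then obtain b c where "(b, c) \<in> parcs G" "x = (if b = v then u else b)" "y = (if c = v then u else c)"
      unfolding parcs_contract_edge by blast
    moreover from this have "b \<in> B x" "c \<in> B y" by (simp_all add: B_def)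
    ultimately show "x \<in> pverts ?M \<and> y \<in> pverts ?M \<and> (\<exists>b\<in>B x. \<exists>c\<in>B y. (b, c) \<in> parcs G)"
      using pair_graphD(2,3)[OF pair_graph_contract_edge[OF G uv] xy] by blast
  next
    fix x b assume xb: "x \<in> pverts ?M" "b \<in> B x"
    show "b \<in> pverts G \<and> f b \<le> f (a x)"
    proof (cases "x = u")
      case True
      then have "b = u \<or> b = v" using xb(2) by (simp add: B_def)
      then show ?thesis using True g(1,2) by (auto simp: a_def)
    next
      case False
      then show ?thesis using xb V by (simp add: a_def B_def)
    qed
  next
    fix x y b assume "x \<in> pverts ?M" "y \<in> pverts ?M" "b \<in> B x" "b \<in> B y"
    then show "x = y" using V by (auto simp: B_def split: if_splits)
  qed (simp add: a_def B_def)
  moreover have "a ` pverts ?M \<subseteq> pverts G" using V g by (auto simp: a_def)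
  ultimately show "\<exists>a. a ` pverts ?M \<subseteq> pverts G \<and> separated ?M (f \<circ> a)" by blast
qed

lemma tree_depth_minor_step_le:
  assumes "minor_step G M" "pair_graph G"
  shows "tree_depth M \<le> tree_depth G"
  using assms
proof cases
  case (del_vertex v)
  then show ?thesis using assms
    by (intro tree_depth_mono_if_embeds[of _ _ id])
      (auto simp: delete_vertex_def embeds_def intro: pair_graph_minor_step)
next
  case (del_edge u v)
  then show ?thesis using assms
    by (intro tree_depth_mono_if_embeds[of _ _ id])
      (auto simp: delete_edge_def embeds_def intro: pair_graph_minor_step)
next
  case (contr_edge u v)
  then show ?thesis using assms(2) by (simp add: tree_depth_contract_edge_le)
qed

text \<open>Tree-depth never grows along minor steps, so the first step already decides.\<close>

lemma critical_iff:
  assumes "pair_graph G"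
  shows "critical G \<longleftrightarrow> (\<forall>M. minor_step G M \<longrightarrow> tree_depth M < tree_depth G)"
proof
  assume step: "\<forall>M. minor_step G M \<longrightarrow> tree_depth M < tree_depth G"
  have "pair_graph M \<and> tree_depth M < tree_depth G" if "minor_step\<^sup>+\<^sup>+ G M" for M
    using that
  proof (induction rule: tranclp_induct)
    case (base M)
    then show ?case using assms step pair_graph_minor_step by blast
  next
    case (step M N)
    then show ?case using tree_depth_minor_step_le pair_graph_minor_step by fastforce
  qed
  then show "critical G" by (auto simp: critical_def proper_minor_def)
qed (auto simp: critical_def proper_minor_def)

text \<open>Were \<open>C\<close> a nonempty union of components missing a vertex, a ranking of \<open>G\<close> minus a vertex
  outside \<open>C\<close> would rank \<open>C\<close>, and a ranking of \<open>G\<close> minus a vertex of \<open>C\<close> would rank the rest,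
  both with fewer than \<open>tree_depth G\<close> labels.\<close>

lemma critical_connected:
  assumes G: "pair_graph G" and crit: "critical G" and ab: "a \<in> pverts G" "b \<in> pverts G"
  shows "(a, b) \<in> (parcs G)\<^sup>*"
proof (rule ccontr)
  assume nab: "(a, b) \<notin> (parcs G)\<^sup>*"
  define C where "C = {x. (a, x) \<in> (parcs G)\<^sup>*}"
  have C: "a \<in> C" "b \<notin> C" using nab by (auto simp: C_def)
  have sym: "(y, x) \<in> parcs G" if "(x, y) \<in> parcs G" for x y
    using pair_graphD(4)[OF G] that .
  have closed: "x \<in> C \<longleftrightarrow> y \<in> C" if "(x, y) \<in> parcs G" for x y
    using that sym[OF that] by (auto simp: C_def intro: rtrancl_into_rtrancl)
  have "\<exists>f. is_ranking (tree_depth G - 1) (delete_vertex G v) f" if "v \<in> pverts G" for v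
  proof -
    have "tree_depth (delete_vertex G v) < tree_depth G"
      using crit that by (auto simp: critical_iff[OF G] intro: minor_step.intros)
    then show ?thesis using ex_ranking_iff[OF pair_graph_delete_vertex[OF G]] by fastforce
  qed
  then obtain fa fb where
    "is_ranking (tree_depth G - 1) (delete_vertex G a) fa"
    "is_ranking (tree_depth G - 1) (delete_vertex G b) fb" using ab by blast
  then have fa: "separated (delete_vertex G a) fa" "\<And>x. x \<in> pverts G \<Longrightarrow> x \<noteq> a \<Longrightarrow> fa x \<in> {1..tree_depth G - 1}"
    and fb: "separated (delete_vertex G b) fb" "\<And>x. x \<in> pverts G \<Longrightarrow> x \<noteq> b \<Longrightarrow> fb x \<in> {1..tree_depth G - 1}"
    using is_ranking_iff[OF pair_graph_delete_vertex[OF G]] by (auto simp: delete_vertex_def)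
  define f where "f = (\<lambda>x. if x \<in> C then fb x else fa x)"
  have "separated G f"
  proof (rule separatedI)
    fix x y assume xy: "x \<in> pverts G" "y \<in> pverts G" "f x = f y"
      "(x, y) \<in> (low_arcs G f (f x))\<^sup>*"
    define d where "d = (if x \<in> C then b else a)"
    define h where "h = (if x \<in> C then fb else fa)"
    have h: "separated (delete_vertex G d) h" using fa fb by (simp add: d_def h_def)
    have "(y \<in> C \<longleftrightarrow> x \<in> C) \<and> (x, y) \<in> (low_arcs (delete_vertex G d) h (f x))\<^sup>*"
      using xy(4)
    proof (induction rule: rtrancl_induct)
      case (step y z)
      moreover from step have "(z \<in> C \<longleftrightarrow> x \<in> C)" using closed by auto
      moreover from this step have "(y, z) \<in> low_arcs (delete_vertex G d) h (f x)"
        using C by (auto simp: delete_vertex_def d_def h_def f_def split: if_splits)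
      ultimately show ?case by (meson rtrancl.rtrancl_into_rtrancl)
    qed simp
    then have reach: "(x, y) \<in> (low_arcs (delete_vertex G d) h (f x))\<^sup>*"
      and fh: "f x = h x" "f y = h y" "x \<noteq> d" "y \<noteq> d"
      using C by (auto simp: f_def h_def d_def)
    show "x = y"
    proof (rule separatedD[OF h])
      show "h x = h y" using fh xy(3) by simp
      show "(x, y) \<in> (low_arcs (delete_vertex G d) h (h x))\<^sup>*" using reach fh(1) by simp
    qed (use xy fh in \<open>simp_all add: delete_vertex_def\<close>)
  qed
  moreover have "\<forall>x\<in>pverts G. f x \<in> {1..tree_depth G - 1}"
    using fa(2) fb(2) C by (auto simp: f_def)
  ultimately have "tree_depth G \<le> tree_depth G - 1"
    using is_ranking_iff[OF G] tree_depth_le by blast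
  \<comment> \<open>The contradiction needs a positive tree-depth, as \<open>0 - 1 = 0\<close>.\<close>
  moreover have "tree_depth G > 0"
    using crit ab(1) by (auto simp: critical_iff[OF G] dest: minor_step.intros)
  ultimately show False by simp
qed

lemma digraph_iso_with_projE:
  assumes "digraph_iso (with_proj F) (with_proj G)"
  obtains \<phi> where "inj_on \<phi> (pverts F)" "pverts G = \<phi> ` pverts F"
    "parcs G = map_prod \<phi> \<phi> ` parcs F" 
proof -
  obtain h where h: "pre_digraph.digraph_isomorphism (with_proj F) h"
    and G: "with_proj G = app_iso h (with_proj F)"
    using assms by (auto simp: digraph_iso_def)
  let ?\<phi> = "iso_verts h"
  have hd: "iso_tail h = fst" "iso_head h = snd"
    using G by (metis app_iso_simps(3) with_proj_simps(4))
      (metis G app_iso_simps(4) with_proj_simps(5))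
  have V: "pverts G = ?\<phi> ` pverts F" and A: "parcs G = iso_arcs h ` parcs F"
    using G by (metis app_iso_simps(1) with_proj_simps(1))
      (metis G app_iso_simps(2) with_proj_simps(2))
  have "iso_arcs h e = map_prod ?\<phi> ?\<phi> e" if "e \<in> parcs F" for e
    using h that hd by (cases e, cases "iso_arcs h e")
      (auto simp: pre_digraph.digraph_isomorphism_def dest: bspec)
  with A have "parcs G = map_prod ?\<phi> ?\<phi> ` parcs F" by (simp cong: image_cong)
  moreover have "inj_on ?\<phi> (pverts F)"
    using h by (simp add: pre_digraph.digraph_isomorphism_def)
  ultimately show ?thesis using V that by blast
qed

text \<open>Every minor step of \<open>G\<close> is mirrored by the step at the image vertices of \<open>F\<close>, and what
  remains of \<open>G\<close> still embeds into what remains of \<open>F\<close>. Isomorphic graphs embed into each other,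
  so this makes criticality invariant.\<close>

lemma critical_if_embeds:
  assumes F: "pair_graph F" and G: "pair_graph G" and a: "embeds a G F"
    and crit: "critical F" and td: "tree_depth G = tree_depth F"
  shows "critical G"
  unfolding critical_iff[OF G]
proof (intro allI impI)
  fix M assume M: "minor_step G M"
  have inj: "a x = a y \<longleftrightarrow> x = y" if "x \<in> pverts G" "y \<in> pverts G" for x y
    using a that by (auto simp: embeds_def dest: inj_onD)
  have arc: "(a x, a y) \<in> parcs F" if "(x, y) \<in> parcs G" for x y
    using a that by (auto simp: embeds_def)
  have V: "a x \<in> pverts F" if "x \<in> pverts G" for x
    using a that by (auto simp: embeds_def)
  note GV = pair_graphD(2,3)[OF G]
  have "\<exists>N. minor_step F N \<and> embeds a M N"
    using M
  proof cases
    case (del_vertex v)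
    have "embeds a M (delete_vertex F (a v))"
      using del_vertex inj arc V GV by (auto simp: delete_vertex_def embeds_def inj_on_def)
    then show ?thesis using V del_vertex by (blast intro: minor_step.intros)
  next
    case (del_edge u v)
    have "embeds a M (delete_edge F (a u) (a v))"
      using del_edge inj arc V GV unfolding delete_edge_def embeds_def inj_on_def by auto
    then show ?thesis using arc del_edge by (blast intro: minor_step.intros)
  next
    case (contr_edge u v)
    have uv: "u \<in> pverts G" "v \<in> pverts G" using GV contr_edge(2) by blast+
    have VM: "pverts M = pverts G - {v}" using contr_edge pverts_contract_edge[OF G] by simp
    have "(a x, a y) \<in> parcs (contract_edge F (a u) (a v))" if xy: "(x, y) \<in> parcs M" for x y
    proof -
      obtain b c where bc: "(b, c) \<in> parcs G" "x \<noteq> y"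
        "x = (if b = v then u else b)" "y = (if c = v then u else c)"
        using xy unfolding contr_edge(1) parcs_contract_edge by blast
      have bcV: "b \<in> pverts G" "c \<in> pverts G" using GV bc(1) by blast+
      have "a x \<noteq> a y" using bc(2-4) bcV uv inj by auto
      moreover have "a x = (if a b = a v then a u else a b)" "a y = (if a c = a v then a u else a c)"
        using bc(3,4) bcV uv inj by auto
      ultimately show ?thesis using arc[OF bc(1)] unfolding parcs_contract_edge by blast
    qed
    moreover have "inj_on a (pverts M)" using VM inj by (auto simp: inj_on_def)
    moreover have "a ` pverts M \<subseteq> pverts (contract_edge F (a u) (a v))"
      using VM V inj uv pverts_contract_edge[OF F arc[OF contr_edge(2)]] by auto
    ultimately have "embeds a M (contract_edge F (a u) (a v))" unfolding embeds_def by blast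
    then show ?thesis using arc contr_edge by (blast intro: minor_step.intros)
  qed
  then obtain N where N: "minor_step F N" "embeds a M N" by blast
  have "tree_depth M \<le> tree_depth N"
    by (rule tree_depth_mono_if_embeds[OF pair_graph_minor_step[OF N(1) F]
      pair_graph_minor_step[OF M G] N(2)])
  also have "\<dots> < tree_depth F" using crit N(1) by (simp add: critical_iff[OF F])
  finally show "tree_depth M < tree_depth G" using td by simp
qed

lemma one_unique_if_embeds:
  assumes F: "pair_graph F" and G: "pair_graph G" and a: "embeds a G F"
    and ou: "one_unique F" and td: "tree_depth G = tree_depth F"
  shows "one_unique G"
  unfolding one_unique_def
proof
  fix v assume v: "v \<in> pverts G"
  then have "a v \<in> pverts F" using a by (auto simp: embeds_def)
  then obtain f where f: "optimal_ranking F f" "{u \<in> pverts F. f u = 1} = {a v}"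
    using ou unfolding one_unique_def by blast
  have "separated G (f \<circ> a)"
    using f(1) a pair_graphD(2,3)[OF G]
    by (intro separated_pullback) (auto simp: optimal_ranking_def is_ranking_iff[OF F] embeds_def)
  then have "optimal_ranking G (f \<circ> a)"
    using f(1) a by (auto simp: optimal_ranking_def is_ranking_iff[OF F] is_ranking_iff[OF G] embeds_def td)
  moreover have "{u \<in> pverts G. (f \<circ> a) u = 1} = {v}"
  proof -
    have "f (a u) = 1 \<longleftrightarrow> u = v" if "u \<in> pverts G" for u
    proof -
      have "a u \<in> pverts F" using a that by (auto simp: embeds_def)
      then have "f (a u) = 1 \<longleftrightarrow> a u = a v" using f(2) by blast
      then show ?thesis using a that v by (auto simp: embeds_def dest: inj_onD)
    qed
    then show ?thesis using v by auto
  qed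
  ultimately show "\<exists>f. optimal_ranking G f \<and> {u \<in> pverts G. f u = 1} = {v}" by blast
qed

lemma iso_invariance:
  assumes F: "pair_graph F" and iso: "digraph_iso (with_proj F) (with_proj G)"
  shows "pair_graph G" "tree_depth G = tree_depth F" "card (pverts G) = card (pverts F)"
    "critical F \<Longrightarrow> critical G" "one_unique F \<Longrightarrow> one_unique G"
proof -
  obtain \<phi> where \<phi>: "inj_on \<phi> (pverts F)" "pverts G = \<phi> ` pverts F"
    "parcs G = map_prod \<phi> \<phi> ` parcs F"
    using digraph_iso_with_projE[OF iso] .
  note FD = pair_graphD[OF F]
  show G: "pair_graph G"
  proof (rule pair_graphI)
    show "finite (pverts G)" using \<phi>(2) FD(1) by simp
    fix x y assume "(x, y) \<in> parcs G"
    then obtain a b where ab: "(a, b) \<in> parcs F" "x = \<phi> a" "y = \<phi> b"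
      unfolding \<phi>(3) in_map_prod_image_iff by blast
    show "x \<in> pverts G \<and> y \<in> pverts G \<and> (y, x) \<in> parcs G \<and> x \<noteq> y"
      using FD(2-5)[OF ab(1)] ab(2,3) \<phi>(1) unfolding \<phi>(2,3) in_map_prod_image_iff
      by (blast dest: inj_onD)
  qed
  define \<psi> where "\<psi> = inv_into (pverts F) \<phi>"
  have inv: "\<psi> (\<phi> x) = x" if "x \<in> pverts F" for x
    using \<phi>(1) that by (simp add: \<psi>_def)
  have E1: "embeds \<phi> F G"
    unfolding embeds_def \<phi>(2,3) in_map_prod_image_iff using \<phi>(1) by blast
  have E2: "embeds \<psi> G F"
    unfolding embeds_def
  proof (intro conjI allI impI)
    show "inj_on \<psi> (pverts G)" by (rule inj_onI) (auto simp: \<phi>(2) inv)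
    show "\<psi> ` pverts G \<subseteq> pverts F" by (auto simp: \<phi>(2) inv)
    fix x y assume "(x, y) \<in> parcs G"
    then obtain a b where "(a, b) \<in> parcs F" "x = \<phi> a" "y = \<phi> b"
      unfolding \<phi>(3) in_map_prod_image_iff by blast
    then show "(\<psi> x, \<psi> y) \<in> parcs F" using FD(2,3)[of a b] by (simp add: inv)
  qed
  show td: "tree_depth G = tree_depth F"
    using tree_depth_mono_if_embeds[OF F G E2] tree_depth_mono_if_embeds[OF G F E1] by simp
  show "card (pverts G) = card (pverts F)" using \<phi>(1,2) by (simp add: card_image)
  show "critical F \<Longrightarrow> critical G" using critical_if_embeds[OF F G E2 _ td] .
  show "one_unique F \<Longrightarrow> one_unique G" using one_unique_if_embeds[OF F G E2 _ td] .
qed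

section \<open>Gluing rankings\<close>

text \<open>The labels up to \<open>t\<close> split \<open>M\<close> into pieces that are ranked separately by \<open>q\<close>. The labels
  above \<open>t\<close> come from a labelling of a smaller graph \<open>H\<close> onto which \<open>\<pi>\<close> projects \<open>M\<close>: a
  walk with labels up to \<open>t + j\<close> projects to a walk of \<open>H\<close> with labels up to \<open>j\<close>, because
  each arc either is collapsed or joins vertices whose projections are at least as low.
  The \<open>max\<close> lets a vertex labelled at most \<open>t\<close> project to a vertex of label \<open>0\<close> in \<open>H\<close>.\<close>

lemma separated_glue:
  fixes M :: "('a \<times> 'b) pair_pre_digraph" and P :: "'a \<Rightarrow> 'b pair_pre_digraph"
  assumes piece: "\<And>u x. (u, x) \<in> pverts M \<Longrightarrow> f (u, x) \<le> t \<Longrightarrow>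
      x \<in> pverts (P u) \<and> f (u, x) = q u x \<and> separated (P u) (q u)"
    and piece_arc: "\<And>u x v y. ((u, x), (v, y)) \<in> parcs M \<Longrightarrow> f (u, x) \<le> t \<Longrightarrow> f (v, y) \<le> t \<Longrightarrow>
      u = v \<and> (x, y) \<in> parcs (P u)"
    and sep: "separated H g"
    and high: "\<And>x. x \<in> pverts M \<Longrightarrow> t < f x \<Longrightarrow> \<pi> x \<in> pverts H \<and> f x = t + g (\<pi> x)"
    and high_inj: "\<And>x y. x \<in> pverts M \<Longrightarrow> y \<in> pverts M \<Longrightarrow> t < f x \<Longrightarrow> t < f y \<Longrightarrow> \<pi> x = \<pi> y \<Longrightarrow> x = y"
    and high_arc: "\<And>x y. (x, y) \<in> parcs M \<Longrightarrow> \<pi> x = \<pi> y \<or>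
      (\<pi> x, \<pi> y) \<in> parcs H \<and> t + g (\<pi> x) \<le> max t (f x) \<and> t + g (\<pi> y) \<le> max t (f y)"
    and M: "pair_graph M"
  shows "separated M f"
proof (rule separatedI)
  fix x y assume xy: "x \<in> pverts M" "y \<in> pverts M" "f x = f y"
    "(x, y) \<in> (low_arcs M f (f x))\<^sup>*"
  show "x = y"
  proof (cases "f x \<le> t")
    case True
    obtain u a v b where ab: "x = (u, a)" "y = (v, b)" by fastforce
    have "fst y = u \<and> (a, snd y) \<in> (low_arcs (P u) (q u) (f x))\<^sup>*"
      using xy(4)
    proof (induction rule: rtrancl_induct)
      case base
      then show ?case by (simp add: ab)
    next
      case (step y z)
      obtain c d where yz: "y = (u, c)" "z = (d, snd z)"
        using step.IH by (cases y, cases z) simp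
      have arc: "((u, c), (d, snd z)) \<in> parcs M" "f (u, c) \<le> f x" "f (d, snd z) \<le> f x"
        using step.hyps(2) yz by simp_all
      then have "d = u" "(c, snd z) \<in> parcs (P u)" using piece_arc[OF arc(1)] True by auto
      moreover have "f (u, c) = q u c" "f (d, snd z) = q d (snd z)"
        using piece arc True pair_graphD(2,3)[OF M arc(1)] by auto
      ultimately have "(c, snd z) \<in> low_arcs (P u) (q u) (f x)" using arc by simp
      then have "(a, snd z) \<in> (low_arcs (P u) (q u) (f x))\<^sup>*"
        using step.IH yz(1) by (auto intro: rtrancl_into_rtrancl)
      then show ?case using \<open>d = u\<close> yz(2) by (metis fst_conv)
    qed
    then have "v = u" and reach: "(a, b) \<in> (low_arcs (P u) (q u) (f x))\<^sup>*" by (simp_all add: ab)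
    have pa: "a \<in> pverts (P u)" "f x = q u a" "separated (P u) (q u)"
      using piece[of u a] xy(1) True ab by auto
    have pb: "b \<in> pverts (P u)" "f y = q u b"
      using piece[of u b] xy(2,3) True ab \<open>v = u\<close> by auto
    have "a = b"
      by (rule separatedD[OF pa(3,1) pb(1)]) (use pa(2) pb(2) xy(3) reach in simp_all)
    then show ?thesis by (simp add: ab \<open>v = u\<close>)
  next
    case False
    define j where "j = f x - t"
    have "(\<pi> x, \<pi> y) \<in> (low_arcs H g j)\<^sup>*"
      using xy(4)
    proof (induction rule: rtrancl_induct)
      case (step y z)
      then have yz: "(y, z) \<in> parcs M" "f y \<le> f x" "f z \<le> f x" by auto
      have "\<pi> y = \<pi> z \<or> (\<pi> y, \<pi> z) \<in> low_arcs H g j"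
        using high_arc[OF yz(1)] yz(2,3) False by (auto simp: j_def)
      then show ?case using step.IH by (metis rtrancl.rtrancl_into_rtrancl)
    qed simp
    moreover have "\<pi> x \<in> pverts H" "\<pi> y \<in> pverts H" "g (\<pi> x) = j" "g (\<pi> y) = j"
      using high[OF xy(1)] high[OF xy(2)] False xy(3) by (auto simp: j_def)
    ultimately have "\<pi> x = \<pi> y" using separatedD[OF sep] by metis
    then show ?thesis using high_inj xy(1-3) False by simp
  qed
qed

section \<open>Adjunctions of critical 1-unique graphs\<close>

lemma critical_minor_ranking:
  assumes "pair_graph G" "critical G" "minor_step G N" "tree_depth G \<le> Suc n"
  shows "\<exists>f. separated N f \<and> (\<forall>x\<in>pverts N. f x \<in> {1..n})"
proof -
  have N: "pair_graph N" using assms(3,1) by (rule pair_graph_minor_step)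
  have "tree_depth N < tree_depth G" using assms by (simp add: critical_iff)
  then have "\<exists>f. is_ranking n N f" using assms(4) by (simp add: ex_ranking_iff[OF N])
  then show ?thesis by (auto simp: is_ranking_iff[OF N])
qed

lemma one_unique_ranking:
  assumes G: "pair_graph G" and "one_unique G" "v \<in> pverts G"
  shows "\<exists>f. separated G f \<and> f v = 1 \<and> (\<forall>x\<in>pverts G - {v}. f x \<in> {2..tree_depth G}) \<and> 1 \<le> tree_depth G"
proof -
  obtain f where f: "is_ranking (tree_depth G) G f" "{u \<in> pverts G. f u = 1} = {v}"
    using assms(2,3) by (auto simp: one_unique_def optimal_ranking_def)
  have r: "separated G f" "\<And>x. x \<in> pverts G \<Longrightarrow> 1 \<le> f x \<and> f x \<le> tree_depth G"
    using f(1) by (auto simp: is_ranking_iff[OF G])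
  have 1: "f x = 1 \<longleftrightarrow> x = v" if "x \<in> pverts G" for x using f(2) that by blast
  have "f x \<in> {2..tree_depth G}" if "x \<in> pverts G - {v}" for x
    using r(2)[of x] 1[of x] that by simp
  moreover have "f v = 1" "1 \<le> tree_depth G" using 1[of v] r(2)[of v] assms(3) by auto
  ultimately show ?thesis using r(1) by blast
qed

lemma separated_delete_vertex: 
  assumes "separated G f" "pair_graph G"
  shows "separated (delete_vertex G v) f"
  using separated_pullback[OF assms(1), of id "delete_vertex G v"] pair_graphD(2,3)[OF assms(2)]
  by (auto simp: delete_vertex_def)

lemma pverts_delete_vertex [simp]: "pverts (delete_vertex G v) = pverts G - {v}"
  by (simp add: delete_vertex_def)

lemma parcs_delete_vertex [simp]:
  "(x, y) \<in> parcs (delete_vertex G v) \<longleftrightarrow> (x, y) \<in> parcs G \<and> x \<noteq> v \<and> y \<noteq> v"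
  by (simp add: delete_vertex_def)

lemma pverts_delete_edge [simp]: "pverts (delete_edge G u v) = pverts G"
  by (simp add: delete_edge_def)

lemma parcs_delete_edge [simp]:
  "(x, y) \<in> parcs (delete_edge G u v) \<longleftrightarrow> (x, y) \<in> parcs G \<and> (x, y) \<noteq> (u, v) \<and> (x, y) \<noteq> (v, u)"
  by (simp add: delete_edge_def)

lemma in_pverts_adjoin [simp]:
  "(u, x) \<in> pverts (adjoin H L w) \<longleftrightarrow> u \<in> pverts H \<and> x \<in> pverts (L u)"
  by (simp add: adjoin_def)

lemma in_parcs_adjoin:
  "((u, x), (v, y)) \<in> parcs (adjoin H L w) \<longleftrightarrow>
     (u, v) \<in> parcs H \<and> x = w u \<and> y = w v \<or> u = v \<and> u \<in> pverts H \<and> (x, y) \<in> parcs (L u)"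
  by (auto simp: adjoin_def)

locale adjunction =
  fixes H :: "'a pair_pre_digraph" and L :: "'a \<Rightarrow> 'b pair_pre_digraph" and w :: "'a \<Rightarrow> 'b"
    and r s :: nat
  assumes H: "pair_graph H" "critical H" "one_unique H" "tree_depth H = s"
    and L: "\<And>v. v \<in> pverts H \<Longrightarrow> pair_graph (L v)" "\<And>v. v \<in> pverts H \<Longrightarrow> critical (L v)"
      "\<And>v. v \<in> pverts H \<Longrightarrow> one_unique (L v)" "\<And>v. v \<in> pverts H \<Longrightarrow> tree_depth (L v) = r + 1"
    and w: "\<And>v. v \<in> pverts H \<Longrightarrow> w v \<in> pverts (L v)"
begin

lemma pair_graph_adjoin: "pair_graph (adjoin H L w)"
proof (rule pair_graphI)
  show "finite (pverts (adjoin H L w))"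
    using pair_graphD(1)[OF H(1)] pair_graphD(1)[OF L(1)] by (simp add: adjoin_def)
  fix x y assume xy: "(x, y) \<in> parcs (adjoin H L w)"
  obtain u a v b where ab: "x = (u, a)" "y = (v, b)" by fastforce
  consider "(u, v) \<in> parcs H" "a = w u" "b = w v" | "u = v" "u \<in> pverts H" "(a, b) \<in> parcs (L u)"
    using xy unfolding ab in_parcs_adjoin by blast
  then show "x \<in> pverts (adjoin H L w) \<and> y \<in> pverts (adjoin H L w) \<and>
      (y, x) \<in> parcs (adjoin H L w) \<and> x \<noteq> y"
  proof cases
    case 1
    then show ?thesis using pair_graphD(2-5)[OF H(1) 1(1)] w
      unfolding ab by (simp add: in_parcs_adjoin)
  next
    case 2
    then show ?thesis using pair_graphD(2-5)[OF L(1)[OF 2(2)] 2(3)]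
      unfolding ab by (simp add: in_parcs_adjoin)
  qed
qed

text \<open>The ranking behind both 1-uniqueness (\<open>L' = L v\<close>, \<open>t = r + 1\<close>) and the minors taken inside
  \<open>L v\<close> (\<open>L'\<close> a minor of \<open>L v\<close>, \<open>t = r\<close>). The piece at \<open>v\<close> is ranked as a whole by \<open>1..t\<close>,
  its attaching point included, because \<open>v\<close> is the only vertex with label \<open>1\<close> in \<open>g\<close>: a path
  leaving this piece enters the next one at a label above \<open>t\<close>. The other vertices of \<open>H\<close> have
  labels \<open>2..s\<close>, which become \<open>t + 1..t + s - 1\<close>. The set of attaching points in \<open>L'\<close> is left
  arbitrary, since a contraction may move it.\<close>

lemma piece_ranking:
  assumes v: "v \<in> pverts H"
    and L': "separated L' h'" "\<forall>x\<in>pverts L'. h' x \<in> {1..t}"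
    and h: "\<And>u. u \<in> pverts H \<Longrightarrow> u \<noteq> v \<Longrightarrow> separated (delete_vertex (L u) (w u)) (h u) \<and>
        (\<forall>x\<in>pverts (L u) - {w u}. h u x \<in> {1..t})"
    and g: "separated H g" "g v = 1" "\<forall>u\<in>pverts H - {v}. g u \<in> {2..s}"
    and M: "pair_graph M"
    and verts: "\<And>u x. (u, x) \<in> pverts M \<Longrightarrow>
        u \<in> pverts H \<and> x \<in> pverts (if u = v then L' else L u)"
    and arcs: "\<And>a x b y. ((a, x), (b, y)) \<in> parcs M \<Longrightarrow>
        a = b \<and> (x, y) \<in> parcs (if a = v then L' else L a) \<or>
        (a, b) \<in> parcs H \<and> (a = v \<or> x = w a) \<and> (b = v \<or> y = w b)"
  shows "is_ranking (t + s - 1) M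
    (\<lambda>(u, x). if u = v then h' x else if x = w u then t + g u - 1 else h u x)"
proof -
  define f where "f = (\<lambda>(u, x). if u = v then h' x else if x = w u then t + g u - 1 else h u x)"
  have fv: "f (v, x) = h' x" for x by (simp add: f_def)
  have fw: "f (u, w u) = t + (g u - 1)" "t < f (u, w u)" "f (u, w u) \<le> t + s - 1"
    if "u \<in> pverts H" "u \<noteq> v" for u
  proof -
    have "2 \<le> g u \<and> g u \<le> s" using g(3) that by auto
    then show "f (u, w u) = t + (g u - 1)" "t < f (u, w u)" "f (u, w u) \<le> t + s - 1"
      using that by (auto simp: f_def)
  qed
  have fh: "f (u, x) = h u x" "h u x \<le> t" "1 \<le> h u x"
    if "u \<in> pverts H" "u \<noteq> v" "x \<in> pverts (L u)" "x \<noteq> w u" for u x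
    using h that by (auto simp: f_def)
  have low: "u = v \<or> x \<noteq> w u" if "(u, x) \<in> pverts M" "f (u, x) \<le> t" for u x
    using fw(2)[of u] verts that by auto
  have high: "u \<noteq> v \<and> x = w u" if "(u, x) \<in> pverts M" "f (u, x) > t" for u x
  proof -
    have "u \<noteq> v" using that(2) verts[OF that(1)] L'(2) fv by fastforce
    then show ?thesis using fh[of u x] verts[OF that(1)] that(2) by fastforce
  qed
  have "separated M f"
  proof (rule separated_glue[where t = t and H = H and g = "(\<lambda>n. n - 1) \<circ> g" and \<pi> = fst
        and P = "\<lambda>u. if u = v then L' else delete_vertex (L u) (w u)"
        and q = "\<lambda>u. if u = v then h' else h u"])
    fix u x assume "(u, x) \<in> pverts M" "f (u, x) \<le> t"
    then show "x \<in> pverts (if u = v then L' else delete_vertex (L u) (w u)) \<and>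
        f (u, x) = (if u = v then h' else h u) x \<and>
        separated (if u = v then L' else delete_vertex (L u) (w u)) (if u = v then h' else h u)"
      using low[of u x] verts[of u x] h[of u] L'(1) fh(1)[of u x] fv by auto
  next
    fix a x b y assume xy: "((a, x), (b, y)) \<in> parcs M" "f (a, x) \<le> t" "f (b, y) \<le> t"
    then have "a = v \<or> x \<noteq> w a" "b = v \<or> y \<noteq> w b"
      using low pair_graphD(2,3)[OF M xy(1)] by auto
    then show "a = b \<and> (x, y) \<in> parcs (if a = v then L' else delete_vertex (L a) (w a))"
      using arcs[OF xy(1)] pair_graphD(5)[OF H(1)] by auto
  next
    have "strict_mono_on (g ` pverts H) (\<lambda>n. n - 1)"
    proof (rule strict_mono_onI)
      fix m n assume "m \<in> g ` pverts H" "m < n"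
      moreover have "1 \<le> g u" if "u \<in> pverts H" for u 
        using g(2) bspec[OF g(3), of u] that by (cases "u = v") auto
      ultimately show "m - 1 < n - 1" by fastforce
    qed
    then show "separated H ((\<lambda>n. n - 1) \<circ> g)" using separated_transfer[OF g(1) _ H(1)] by blast
  next
    fix z assume z: "z \<in> pverts M" "t < f z"
    obtain u x where ux: "z = (u, x)" by fastforce
    show "fst z \<in> pverts H \<and> f z = t + ((\<lambda>n. n - 1) \<circ> g) (fst z)"
      using high[of u x] verts[of u x] fw(1)[of u] z by (simp add: ux)
  next
    fix x y assume "x \<in> pverts M" "y \<in> pverts M" "t < f x" "t < f y" "fst x = fst y"
    then show "x = y"
      using high by (cases x, cases y) fastforce
  next
    fix x y assume xy: "(x, y) \<in> parcs M"
    obtain a c b d where ab: "x = (a, c)" "y = (b, d)" by fastforce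
    have bound: "t + ((\<lambda>n. n - 1) \<circ> g) u \<le> max t (f (u, e))"
      if "u \<in> pverts H" "u = v \<or> e = w u" for u e
      using that g(2) fw(1)[of u] by (cases "u = v") simp_all
    have "(a, c) \<in> pverts M" "(b, d) \<in> pverts M"
      using pair_graphD(2,3)[OF M xy] by (simp_all add: ab)
    then have V: "a \<in> pverts H" "b \<in> pverts H" using verts by auto
    consider "a = b" | "(a, b) \<in> parcs H" "a = v \<or> c = w a" "b = v \<or> d = w b"
      using arcs[of a c b d] xy unfolding ab by blast
    then show "fst x = fst y \<or> (fst x, fst y) \<in> parcs H \<and>
        t + ((\<lambda>n. n - 1) \<circ> g) (fst x) \<le> max t (f x) \<and> t + ((\<lambda>n. n - 1) \<circ> g) (fst y) \<le> max t (f y)"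
      using bound V unfolding ab by cases simp_all
  qed (rule M)
  moreover have "f z \<in> {1..t + s - 1}" if z: "z \<in> pverts M" for z
  proof -
    obtain u x where ux: "z = (u, x)" by fastforce
    have s: "1 \<le> s"
    proof -
      have "\<exists>f. is_ranking (tree_depth H) H f" using ex_optimal_ranking[OF H(1)] by blast
      then show ?thesis using v by (auto simp: is_ranking_iff[OF H(1)] H(4))
    qed
    have uH: "u \<in> pverts H" using verts z ux by blast
    show ?thesis
    proof (cases "u = v")
      case True
      then show ?thesis using L'(2) verts[of u x] z s by (auto simp: ux fv)
    next
      case False
      then show ?thesis
        using fw(2,3)[OF uH False] fh[OF uH False, of x] verts[of u x] z s unfolding ux
        by (cases "x = w u") auto
    qed
  qed
  ultimately show ?thesis unfolding is_ranking_iff[OF M] f_def by blast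
qed

text \<open>The ranking for minors taken in \<open>H\<close>: the vertices of \<open>H'\<close> lie above all branches
  \<open>L u\<close> with their attaching vertex removed. When the edge \<open>uv\<close> of \<open>H\<close> is contracted, the
  branches of \<open>u\<close> and \<open>v\<close> hang at the same vertex \<open>u\<close>; then \<open>c\<close> sends \<open>v\<close> to \<open>u\<close>, while the
  first components still keep the two branches apart. For a deletion \<open>c\<close> is the identity.\<close>

lemma base_ranking:
  fixes c :: "'a \<Rightarrow> 'a"
  assumes h: "\<And>u. u \<in> pverts H \<Longrightarrow> separated (delete_vertex (L u) (w u)) (h u) \<and>
        (\<forall>x\<in>pverts (L u) - {w u}. h u x \<in> {1..t})"
    and g: "separated H' g" "\<forall>u\<in>pverts H'. g u \<in> {1..m}"
    and M: "pair_graph M"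
    and verts: "\<And>u x. (u, x) \<in> pverts M \<Longrightarrow> u \<in> pverts H \<and> x \<in> pverts (L u) \<and>
        (x = w u \<longrightarrow> u \<in> pverts H' \<and> c u = u)"
    and arcs: "\<And>a x b y. ((a, x), (b, y)) \<in> parcs M \<Longrightarrow>
        a = b \<and> x \<noteq> w a \<and> y \<noteq> w b \<and> (x, y) \<in> parcs (L a) \<or>
        c a = c b \<and> (x = w a \<or> y = w b) \<or>
        x = w a \<and> y = w b \<and> (a, b) \<in> parcs H'"
  shows "is_ranking (t + m) M (\<lambda>(u, x). if x = w u then t + g u else h u x)"
proof -
  define f where "f = (\<lambda>(u, x). if x = w u then t + g u else h u x)"
  have fw: "f (u, w u) = t + g u" for u by (simp add: f_def)
  have gt: "t < t + g u" "t + g u \<le> t + m" if "u \<in> pverts H'" for u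
    using g(2) that by fastforce+
  have fh: "f (u, x) = h u x" "h u x \<le> t" "1 \<le> h u x"
    if "u \<in> pverts H" "x \<in> pverts (L u)" "x \<noteq> w u" for u x
    using h that by (auto simp: f_def)
  have low_iff: "t < f (u, x) \<longleftrightarrow> x = w u" if ux: "(u, x) \<in> pverts M" for u x
    using verts[OF ux] gt(1)[of u] fw[of u] fh[of u x] by fastforce
  have "separated M f"
  proof (rule separated_glue[where t = t and H = H' and g = g and \<pi> = "c \<circ> fst"
        and P = "\<lambda>u. delete_vertex (L u) (w u)" and q = h])
    fix u x assume "(u, x) \<in> pverts M" "f (u, x) \<le> t"
    then show "x \<in> pverts (delete_vertex (L u) (w u)) \<and> f (u, x) = h u x \<and>
        separated (delete_vertex (L u) (w u)) (h u)"
      using low_iff[of u x] verts[of u x] h[of u] fh(1)[of u x] by auto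
  next
    fix a x b y assume xy: "((a, x), (b, y)) \<in> parcs M" "f (a, x) \<le> t" "f (b, y) \<le> t"
    then have "x \<noteq> w a" "y \<noteq> w b"
      using low_iff pair_graphD(2,3)[OF M xy(1)] by fastforce+
    then show "a = b \<and> (x, y) \<in> parcs (delete_vertex (L a) (w a))"
      using arcs[OF xy(1)] by auto
  next
    fix z assume z: "z \<in> pverts M" "t < f z"
    obtain u x where ux: "z = (u, x)" by fastforce
    show "(c \<circ> fst) z \<in> pverts H' \<and> f z = t + g ((c \<circ> fst) z)"
      using low_iff[of u x] verts[of u x] fw[of u] z by (simp add: ux)
  next
    fix x y assume "x \<in> pverts M" "y \<in> pverts M" "t < f x" "t < f y" "(c \<circ> fst) x = (c \<circ> fst) y"
    moreover obtain u a v b where "x = (u, a)" "y = (v, b)" by fastforce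
    ultimately show "x = y"
      using low_iff[of u a] low_iff[of v b] verts[of u a] verts[of v b] by simp
  next
    fix x y assume xy: "(x, y) \<in> parcs M"
    obtain a d b e where ab: "x = (a, d)" "y = (b, e)" by fastforce
    have "(a, d) \<in> pverts M" "(b, e) \<in> pverts M"
      using pair_graphD(2,3)[OF M xy] by (simp_all add: ab)
    then have V: "d = w a \<Longrightarrow> c a = a" "e = w b \<Longrightarrow> c b = b" using verts by auto
    consider "a = b" | "c a = c b" | "d = w a" "e = w b" "(a, b) \<in> parcs H'"
      using arcs[of a d b e] xy unfolding ab by blast
    then show "(c \<circ> fst) x = (c \<circ> fst) y \<or> ((c \<circ> fst) x, (c \<circ> fst) y) \<in> parcs H' \<and>
        t + g ((c \<circ> fst) x) \<le> max t (f x) \<and> t + g ((c \<circ> fst) y) \<le> max t (f y)"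
      using V unfolding ab by cases (simp_all add: fw)
  qed (fact g(1), fact M)
  moreover have "f z \<in> {1..t + m}" if z: "z \<in> pverts M" for z
  proof -
    obtain u x where ux: "z = (u, x)" by fastforce
    show ?thesis
      using verts[of u x] z gt[of u] fw[of u] fh[of u x] unfolding ux
      by (cases "x = w u") auto
  qed
  ultimately show ?thesis unfolding is_ranking_iff[OF M] f_def by blast
qed

lemma ex_branch_rankings:
  "\<exists>h. \<forall>u\<in>pverts H. separated (delete_vertex (L u) (w u)) (h u) \<and>
      (\<forall>x\<in>pverts (L u) - {w u}. h u x \<in> {1..r})"
proof (rule bchoice, rule ballI)
  fix u assume u: "u \<in> pverts H"
  have "tree_depth (L u) \<le> Suc r" using L(4)[OF u] by simp
  from critical_minor_ranking[OF L(1,2)[OF u] minor_step.del_vertex[OF w[OF u]] this]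
  show "\<exists>h. separated (delete_vertex (L u) (w u)) h \<and> (\<forall>x\<in>pverts (L u) - {w u}. h x \<in> {1..r})"
    by simp
qed

text \<open>Rank \<open>L v\<close> with its only \<open>1\<close> at \<open>x\<close>, every other \<open>L u\<close> with its only \<open>1\<close> at \<open>w u\<close>, and \<open>H\<close>
  with its only \<open>1\<close> at \<open>v\<close>. The labels \<open>1\<close> at the \<open>w u\<close> are then overwritten by large
  labels from \<open>H\<close>, which leaves a single \<open>1\<close> in the adjunction.\<close>

lemma ranking_with_unique_label_one:
  assumes "(v, x) \<in> pverts (adjoin H L w)"
  shows "\<exists>f. is_ranking (r + s) (adjoin H L w) f \<and> {z \<in> pverts (adjoin H L w). f z = 1} = {(v, x)}"
proof -
  have v: "v \<in> pverts H" and x: "x \<in> pverts (L v)" using assms by simp_all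
  obtain g where g: "separated H g" "g v = 1" "\<forall>u\<in>pverts H - {v}. g u \<in> {2..s}"
    using one_unique_ranking[OF H(1,3) v] H(4) by auto
  obtain h' where h': "separated (L v) h'" "h' x = 1" "\<forall>y\<in>pverts (L v) - {x}. h' y \<in> {2..r + 1}"
    using one_unique_ranking[OF L(1,3)[OF v] x] L(4)[OF v] by auto
  have "\<exists>h. separated (delete_vertex (L u) (w u)) h \<and> (\<forall>y\<in>pverts (L u) - {w u}. h y \<in> {2..r + 1})"
    if u: "u \<in> pverts H" for u
    using one_unique_ranking[OF L(1,3)[OF u] w[OF u]] L(4)[OF u] separated_delete_vertex[OF _ L(1)[OF u]]
    by metis
  then obtain h where h: "\<And>u. u \<in> pverts H \<Longrightarrow> separated (delete_vertex (L u) (w u)) (h u) \<and>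
      (\<forall>y\<in>pverts (L u) - {w u}. h u y \<in> {2..r + 1})" by metis
  define f where "f = (\<lambda>(u, y). if u = v then h' y else if y = w u then (r + 1) + g u - 1 else h u y)"
  have "{2..r + 1} \<subseteq> {1..r + 1}" by simp
  have "is_ranking ((r + 1) + s - 1) (adjoin H L w) f" unfolding f_def
  proof (rule piece_ranking[OF v h'(1)])
    show "\<forall>y\<in>pverts (L v). h' y \<in> {1..r + 1}"
    proof
      fix y assume "y \<in> pverts (L v)"
      then show "h' y \<in> {1..r + 1}"
        using h'(2) bspec[OF h'(3), of y] by (cases "y = x") auto
    qed
    show "separated (delete_vertex (L u) (w u)) (h u) \<and> (\<forall>x\<in>pverts (L u) - {w u}. h u x \<in> {1..r + 1})"
      if "u \<in> pverts H" for u
      using h[OF that] \<open>{2..r + 1} \<subseteq> {1..r + 1}\<close> by blast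
    show "a = b \<and> (x, y) \<in> parcs (if a = v then L v else L a) \<or>
        (a, b) \<in> parcs H \<and> (a = v \<or> x = w a) \<and> (b = v \<or> y = w b)"
      if "((a, x), (b, y)) \<in> parcs (adjoin H L w)" for a x b y
      using that unfolding in_parcs_adjoin by auto
  qed (use g pair_graph_adjoin in auto)
  moreover have "f (u, y) = 1 \<longleftrightarrow> (u, y) = (v, x)" if "u \<in> pverts H" "y \<in> pverts (L u)" for u y
  proof (cases "u = v")
    case True
    then show ?thesis
      using h'(2) bspec[OF h'(3), of y] that by (cases "y = x") (auto simp: f_def)
  next
    case False
    then have "g u \<in> {2..s}" "y \<noteq> w u \<Longrightarrow> h u y \<in> {2..r + 1}" using g(3) h that by auto
    then show ?thesis using False by (auto simp: f_def)
  qed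
  then have "{z \<in> pverts (adjoin H L w). f z = 1} = {(v, x)}" using v x by auto
  ultimately show ?thesis by auto
qed

lemma minor_in_piece:
  assumes v: "v \<in> pverts H" and L': "minor_step (L v) L'"
    and M: "pair_graph M"
    and verts: "\<And>u x. (u, x) \<in> pverts M \<Longrightarrow>
        u \<in> pverts H \<and> x \<in> pverts (if u = v then L' else L u)"
    and arcs: "\<And>a x b y. ((a, x), (b, y)) \<in> parcs M \<Longrightarrow>
        a = b \<and> (x, y) \<in> parcs (if a = v then L' else L a) \<or>
        (a, b) \<in> parcs H \<and> (a = v \<or> x = w a) \<and> (b = v \<or> y = w b)"
  shows "tree_depth M < r + s"
proof -
  obtain g where g: "separated H g" "g v = 1" "\<forall>u\<in>pverts H - {v}. g u \<in> {2..s}" "1 \<le> s"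
    using one_unique_ranking[OF H(1,3) v] H(4) by auto
  obtain h' where h': "separated L' h'" "\<forall>x\<in>pverts L'. h' x \<in> {1..r}"
    using critical_minor_ranking[OF L(1,2)[OF v] L', of r] L(4)[OF v] by auto
  obtain h where h: "\<forall>u\<in>pverts H. separated (delete_vertex (L u) (w u)) (h u) \<and>
      (\<forall>x\<in>pverts (L u) - {w u}. h u x \<in> {1..r})" using ex_branch_rankings by blast
  have "tree_depth M \<le> r + s - 1"
    by (rule tree_depth_le[OF piece_ranking[where h = h, OF v h' _ g(1-3) M verts arcs]]) (use h in blast)+
  then show ?thesis using g(4) by simp
qed

lemma minor_in_base:
  fixes c :: "'a \<Rightarrow> 'a"
  assumes H': "minor_step H H'" and s: "s \<ge> 1" and M: "pair_graph M"
    and verts: "\<And>u x. (u, x) \<in> pverts M \<Longrightarrow> u \<in> pverts H \<and> x \<in> pverts (L u) \<and>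
        (x = w u \<longrightarrow> u \<in> pverts H' \<and> c u = u)"
    and arcs: "\<And>a x b y. ((a, x), (b, y)) \<in> parcs M \<Longrightarrow>
        a = b \<and> x \<noteq> w a \<and> y \<noteq> w b \<and> (x, y) \<in> parcs (L a) \<or>
        c a = c b \<and> (x = w a \<or> y = w b) \<or>
        x = w a \<and> y = w b \<and> (a, b) \<in> parcs H'"
  shows "tree_depth M < r + s"
proof -
  obtain g where g: "separated H' g" "\<forall>x\<in>pverts H'. g x \<in> {1..s - 1}"
    using critical_minor_ranking[OF H(1,2) H', of "s - 1"] H(4) s by fastforce
  obtain h where h: "\<forall>u\<in>pverts H. separated (delete_vertex (L u) (w u)) (h u) \<and>
      (\<forall>x\<in>pverts (L u) - {w u}. h u x \<in> {1..r})" using ex_branch_rankings by blast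
  have "tree_depth M \<le> r + (s - 1)"
    by (rule tree_depth_le[OF base_ranking[where h = h, OF _ g M verts arcs]]) (use h in blast)+
  then show ?thesis using s by simp
qed

end

text \<open>The copy of each \<open>L u\<close> is a connected branch set of \<open>u\<close>, so the largest labels in the
  copies rank \<open>H\<close>. Each of them is at least \<open>tree_depth (L u) = r + 1\<close>; subtracting \<open>r\<close>
  leaves a ranking of \<open>H\<close>, which needs \<open>s\<close> labels.\<close>

lemma (in adjunction) tree_depth_adjoin_ge:
  assumes s: "s \<ge> 1"
  shows "r + s \<le> tree_depth (adjoin H L w)"
proof -
  let ?A = "adjoin H L w"
  obtain f where f: "is_ranking (tree_depth ?A) ?A f" using ex_optimal_ranking[OF pair_graph_adjoin] .
  then have sep: "separated ?A f" and range: "\<And>z. z \<in> pverts ?A \<Longrightarrow> f z \<in> {1..tree_depth ?A}"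
    by (auto simp: is_ranking_iff[OF pair_graph_adjoin])
  define S where "S = (\<lambda>u. {u} \<times> pverts (L u))"
  have SA: "S u \<subseteq> pverts ?A" if "u \<in> pverts H" for u using that by (auto simp: S_def)
  have "\<exists>z. z \<in> S u \<and> (\<forall>b\<in>S u. f b \<le> f z)" if u: "u \<in> pverts H" for u
  proof -
    have fin: "finite (f ` S u)" and ne: "f ` S u \<noteq> {}"
      using pair_graphD(1)[OF L(1)[OF u]] w[OF u] by (auto simp: S_def)
    obtain z where "z \<in> S u" "f z = Max (f ` S u)" using Max_in[OF fin ne] by fastforce
    moreover from this have "\<forall>b\<in>S u. f b \<le> f z" using Max_ge[OF fin] by simp
    ultimately show ?thesis by blast
  qed
  then obtain a where a: "\<And>u. u \<in> pverts H \<Longrightarrow> a u \<in> S u \<and> (\<forall>b\<in>S u. f b \<le> f (a u))"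
    by metis
  have sepH: "separated H (f \<circ> a)"
  proof (rule separated_branch[OF sep, where B = S])
    fix u b c assume u: "u \<in> pverts H" and "b \<in> S u" "c \<in> S u"
    then obtain x y where xy: "b = (u, x)" "c = (u, y)" "x \<in> pverts (L u)" "y \<in> pverts (L u)"
      by (auto simp: S_def)
    have "(x, y) \<in> (parcs (L u))\<^sup>*" using critical_connected[OF L(1,2)[OF u] xy(3,4)] .
    then have "((u, x), (u, y)) \<in> (Restr (parcs ?A) (S u))\<^sup>*"
    proof (induction rule: rtrancl_induct)
      case (step y z)
      then have "((u, y), (u, z)) \<in> Restr (parcs ?A) (S u)"
        using u pair_graphD(2,3)[OF L(1)[OF u] step.hyps(2)] by (simp add: S_def in_parcs_adjoin)
      then show ?case using step.IH by (rule rtrancl_into_rtrancl[rotated])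
    qed simp
    then show "(b, c) \<in> (Restr (parcs ?A) (S u))\<^sup>*" by (simp only: xy)
  next
    fix u v assume uv: "(u, v) \<in> parcs H"
    have V: "u \<in> pverts H" "v \<in> pverts H" using pair_graphD(2,3)[OF H(1) uv] .
    have "(u, w u) \<in> S u" "(v, w v) \<in> S v" using w V by (auto simp: S_def)
    moreover have "((u, w u), (v, w v)) \<in> parcs ?A" using uv by (simp add: in_parcs_adjoin)
    ultimately show "u \<in> pverts H \<and> v \<in> pverts H \<and> (\<exists>b\<in>S u. \<exists>c\<in>S v. (b, c) \<in> parcs ?A)"
      using V by blast
  next
    fix u b assume "u \<in> pverts H" "b \<in> S u"
    then show "b \<in> pverts ?A \<and> f b \<le> f (a u)" using a SA by blast
  qed (use a in \<open>auto simp: S_def\<close>)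
  have ge: "r + 1 \<le> f (a u)" if u: "u \<in> pverts H" for u
  proof -
    have "separated (L u) (f \<circ> Pair u)"
      using pair_graphD(2,3)[OF L(1)[OF u]] u
      by (intro separated_pullback[OF sep]) (auto simp: inj_on_def in_parcs_adjoin)
    moreover have "(f \<circ> Pair u) x \<in> {1..f (a u)}" if "x \<in> pverts (L u)" for x
      using a[OF u] range[of "(u, x)"] that u by (auto simp: S_def)
    ultimately have "is_ranking (f (a u)) (L u) (f \<circ> Pair u)"
      by (simp add: is_ranking_iff[OF L(1)[OF u]])
    then show ?thesis using tree_depth_le L(4)[OF u] by metis
  qed
  \<comment> \<open>Truncated subtraction is harmless because all labels exceed \<open>r\<close>.\<close>
  have "strict_mono_on ((f \<circ> a) ` pverts H) (\<lambda>n. n - r)"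
  proof (rule strict_mono_onI)
    fix m n assume "m \<in> (f \<circ> a) ` pverts H" "m < n"
    then show "m - r < n - r" using ge by fastforce
  qed
  then have "separated H ((\<lambda>n. n - r) \<circ> (f \<circ> a))" by (rule separated_transfer[OF sepH _ H(1)])
  moreover have "((\<lambda>n. n - r) \<circ> (f \<circ> a)) u \<in> {1..tree_depth ?A - r}" if u: "u \<in> pverts H" for u
  proof -
    have "a u \<in> pverts ?A" using a[OF u] SA[OF u] by blast
    then show ?thesis using ge[OF u] range[of "a u"] by auto
  qed
  ultimately have "is_ranking (tree_depth ?A - r) H ((\<lambda>n. n - r) \<circ> (f \<circ> a))"
    by (simp add: is_ranking_iff[OF H(1)])
  then have "s \<le> tree_depth ?A - r" using tree_depth_le H(4) by metis
  then show ?thesis using s by simp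
qed

lemma tree_depth_empty: 
  assumes "pair_graph G" "pverts G = {}" 
  shows "tree_depth G = 0"
proof -
  have "is_ranking 0 G (\<lambda>_. 0)" using assms(2) by (simp add: is_ranking_iff[OF assms(1)] separated_def)
  then show ?thesis using tree_depth_le by fastforce
qed

lemma (in adjunction) tree_depth_adjoin:
  assumes s: "s \<ge> 1"
  shows "tree_depth (adjoin H L w) = r + s"
proof -
  obtain v where v: "v \<in> pverts H" using tree_depth_empty[OF H(1)] H(4) s by fastforce
  then have "(v, w v) \<in> pverts (adjoin H L w)" using w by simp
  then have "tree_depth (adjoin H L w) \<le> r + s"
    using ranking_with_unique_label_one tree_depth_le by blast
  then show ?thesis using tree_depth_adjoin_ge[OF s] by simp
qed

lemma (in adjunction) one_unique_adjoin:
  assumes s: "s \<ge> 1"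
  shows "one_unique (adjoin H L w)"
  unfolding one_unique_def optimal_ranking_def tree_depth_adjoin[OF s]
  using ranking_with_unique_label_one by (metis surj_pair)

text \<open>Every vertex and edge of an adjunction belongs to some \<open>L v\<close> or to \<open>H\<close>, where the step is a
  minor step of a critical graph. A vertex of \<open>H\<close> belongs to both, and is deleted as one of \<open>H\<close>.\<close>

lemma (in adjunction) tree_depth_minor_step_adjoin:
  assumes s: "s \<ge> 1" and M: "minor_step (adjoin H L w) M"
  shows "tree_depth M < r + s"
proof -
  let ?A = "adjoin H L w"
  note A = pair_graph_adjoin
  have MG: "pair_graph M" using M A by (rule pair_graph_minor_step)
  have ne: "u \<noteq> v" if "(u, v) \<in> parcs H" for u v using pair_graphD(5)[OF H(1) that] .
  show ?thesis
    using M
  proof cases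
    case (del_vertex z)
    obtain v x where z: "z = (v, x)" by fastforce
    have v: "v \<in> pverts H" "x \<in> pverts (L v)" using del_vertex(2) by (simp_all add: z)
    show ?thesis
    proof (cases "x = w v")
      case True
      show ?thesis
      proof (rule minor_in_base[OF minor_step.del_vertex[OF v(1)] s MG, of id])
        fix a p b q assume "((a, p), (b, q)) \<in> parcs M"
        then show "a = b \<and> p \<noteq> w a \<and> q \<noteq> w b \<and> (p, q) \<in> parcs (L a) \<or>
            id a = id b \<and> (p = w a \<or> q = w b) \<or>
            p = w a \<and> q = w b \<and> (a, b) \<in> parcs (delete_vertex H v)"
          unfolding del_vertex(1) parcs_delete_vertex in_parcs_adjoin z True by auto
      qed (use del_vertex z True in auto)
    next
      case False
      show ?thesis
      proof (rule minor_in_piece[OF v(1) minor_step.del_vertex[OF v(2)] MG])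
        fix a p b q assume "((a, p), (b, q)) \<in> parcs M"
        then show "a = b \<and> (p, q) \<in> parcs (if a = v then delete_vertex (L v) x else L a) \<or>
            (a, b) \<in> parcs H \<and> (a = v \<or> p = w a) \<and> (b = v \<or> q = w b)"
          unfolding del_vertex(1) parcs_delete_vertex in_parcs_adjoin z by auto
      qed (use del_vertex z in \<open>auto split: if_splits\<close>)
    qed
  next
    case (del_edge z1 z2)
    obtain u x v y where z: "z1 = (u, x)" "z2 = (v, y)" by fastforce
    consider (outer) "(u, v) \<in> parcs H" "x = w u" "y = w v"
      | (inner) "u = v" "u \<in> pverts H" "(x, y) \<in> parcs (L u)"
      using del_edge(2) unfolding z in_parcs_adjoin by blast
    then show ?thesis
    proof cases
      case outer
      show ?thesis
      proof (rule minor_in_base[OF minor_step.del_edge[OF outer(1)] s MG, of id])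
        fix a p b q assume "((a, p), (b, q)) \<in> parcs M"
        then show "a = b \<and> p \<noteq> w a \<and> q \<noteq> w b \<and> (p, q) \<in> parcs (L a) \<or>
            id a = id b \<and> (p = w a \<or> q = w b) \<or>
            p = w a \<and> q = w b \<and> (a, b) \<in> parcs (delete_edge H u v)"
          unfolding del_edge(1) parcs_delete_edge in_parcs_adjoin z outer(2,3) by auto
      qed (use del_edge in auto)
    next
      case inner
      show ?thesis
      proof (rule minor_in_piece[OF inner(2) minor_step.del_edge[OF inner(3)] MG])
        fix a p b q assume "((a, p), (b, q)) \<in> parcs M"
        then show "a = b \<and> (p, q) \<in> parcs (if a = u then delete_edge (L u) x y else L a) \<or>
            (a, b) \<in> parcs H \<and> (a = u \<or> p = w a) \<and> (b = u \<or> q = w b)"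
          unfolding del_edge(1) parcs_delete_edge in_parcs_adjoin z inner(1) by auto
      qed (use del_edge in auto)
    qed
  next
    case (contr_edge z1 z2)
    obtain u x v y where z: "z1 = (u, x)" "z2 = (v, y)" by fastforce
    have V: "pverts M = pverts ?A - {(v, y)}"
      using pverts_contract_edge[OF A contr_edge(2)] by (simp add: contr_edge(1) z)
    have arcs: "\<exists>a' p' b' q'. ((a', p'), (b', q')) \<in> parcs ?A \<and> (a, p) \<noteq> (b, q) \<and>
        (a, p) = (if (a', p') = (v, y) then (u, x) else (a', p')) \<and>
        (b, q) = (if (b', q') = (v, y) then (u, x) else (b', q'))"
      if "((a, p), (b, q)) \<in> parcs M" for a p b q
      using that unfolding contr_edge(1) parcs_contract_edge z by (metis surj_pair)
    consider (outer) "(u, v) \<in> parcs H" "x = w u" "y = w v"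
      | (inner) "u = v" "u \<in> pverts H" "(x, y) \<in> parcs (L u)"
      using contr_edge(2) unfolding z in_parcs_adjoin by blast
    then show ?thesis
    proof cases
      case outer
      define c where "c = (\<lambda>a. if a = v then u else a)"
      have uv: "u \<noteq> v" using ne[OF outer(1)] .
      show ?thesis
      proof (rule minor_in_base[OF minor_step.contr_edge[OF outer(1)] s MG, of c])
        fix a p assume "(a, p) \<in> pverts M"
        then show "a \<in> pverts H \<and> p \<in> pverts (L a) \<and>
            (p = w a \<longrightarrow> a \<in> pverts (contract_edge H u v) \<and> c a = a)"
          unfolding V pverts_contract_edge[OF H(1) outer(1)] outer by (auto simp: c_def)
      next
        fix a p b q assume "((a, p), (b, q)) \<in> parcs M"
        then obtain a' p' b' q' where arc: "((a', p'), (b', q')) \<in> parcs ?A" "(a, p) \<noteq> (b, q)"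
          "(a, p) = (if (a', p') = (v, w v) then (u, w u) else (a', p'))"
          "(b, q) = (if (b', q') = (v, w v) then (u, w u) else (b', q'))"
          using arcs unfolding outer(2,3) by blast
        consider (base) "(a', b') \<in> parcs H" "p' = w a'" "q' = w b'"
          | (piece) "a' = b'" "a' \<in> pverts H" "(p', q') \<in> parcs (L a')"
          using arc(1) unfolding in_parcs_adjoin by blast
        then show "a = b \<and> p \<noteq> w a \<and> q \<noteq> w b \<and> (p, q) \<in> parcs (L a) \<or>
            c a = c b \<and> (p = w a \<or> q = w b) \<or>
            p = w a \<and> q = w b \<and> (a, b) \<in> parcs (contract_edge H u v)"
        proof cases
          case base
          have "a = c a'" "p = w a" "b = c b'" "q = w b"
            using arc(3,4) base(2,3) by (auto simp: c_def split: if_splits)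
          moreover from this have "a \<noteq> b" using arc(2) by blast
          ultimately have "(a, b) \<in> parcs (contract_edge H u v)"
            using base(1) unfolding parcs_contract_edge c_def by blast
          then show ?thesis using \<open>p = w a\<close> \<open>q = w b\<close> by blast
        next
          case piece
          have "p' \<noteq> q'" using pair_graphD(5)[OF L(1)[OF piece(2)] piece(3)] by blast
          show ?thesis
            using arc(3,4) piece(1,3) \<open>p' \<noteq> q'\<close> uv by (auto simp: c_def split: if_splits)
        qed
      qed
    next
      case inner
      show ?thesis
      proof (rule minor_in_piece[OF inner(2) minor_step.contr_edge[OF inner(3)] MG])
        fix a p assume "(a, p) \<in> pverts M"
        then show "a \<in> pverts H \<and> p \<in> pverts (if a = u then contract_edge (L u) x y else L a)"
          using pverts_contract_edge[OF L(1)[OF inner(2)] inner(3)]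
          unfolding V inner(1)[symmetric] by auto
      next
        fix a p b q assume "((a, p), (b, q)) \<in> parcs M"
        then obtain a' p' b' q' where arc: "((a', p'), (b', q')) \<in> parcs ?A" "(a, p) \<noteq> (b, q)"
          "(a, p) = (if (a', p') = (u, y) then (u, x) else (a', p'))"
          "(b, q) = (if (b', q') = (u, y) then (u, x) else (b', q'))"
          using arcs unfolding inner(1) by blast
        have ab: "a = a'" "b = b'" using arc(3,4) by (auto split: if_splits)
        have pq: "a \<noteq> u \<Longrightarrow> p = p'" "b \<noteq> u \<Longrightarrow> q = q'"
          "a = u \<Longrightarrow> p = (if p' = y then x else p')" "b = u \<Longrightarrow> q = (if q' = y then x else q')"
          using arc(3,4) ab by (auto split: if_splits)
        consider (base) "(a, b) \<in> parcs H" "p' = w a" "q' = w b"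
          | (piece) "a = b" "a \<in> pverts H" "(p', q') \<in> parcs (L a)"
          using arc(1) unfolding in_parcs_adjoin ab by blast
        then show "a = b \<and> (p, q) \<in> parcs (if a = u then contract_edge (L u) x y else L a) \<or>
            (a, b) \<in> parcs H \<and> (a = u \<or> p = w a) \<and> (b = u \<or> q = w b)"
        proof cases
          case base
          then show ?thesis using pq by blast
        next
          case piece
          show ?thesis
          proof (cases "a = u")
            case True
            have "p \<noteq> q" using arc(2) piece(1) by blast
            then have "(p, q) \<in> parcs (contract_edge (L u) x y)"
              using piece(1,3) pq(3,4) True unfolding parcs_contract_edge by blast
            then show ?thesis using piece(1) True by simp
          next
            case False
            then show ?thesis using piece pq by simp
          qed
        qed
      qed
    qed
  qed
qed

lemma (in adjunction) critical_adjoin: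
  assumes s: "s \<ge> 1"
  shows "critical (adjoin H L w)"
  unfolding critical_iff[OF pair_graph_adjoin] tree_depth_adjoin[OF s]
  using tree_depth_minor_step_adjoin[OF s] by blast

section \<open>The families built from critical 1-unique graphs\<close>

lemma tree_depth_edgeless:
  assumes M: "pair_graph M" and "\<And>x y. (x, y) \<notin> parcs M"
  shows "tree_depth M \<le> 1"
proof (rule tree_depth_le)
  have "low_arcs M (\<lambda>_. 1) 1 = {}" using assms(2) by (auto simp: low_arcs_def)
  then show "is_ranking 1 M (\<lambda>_. 1)" by (simp add: is_ranking_iff[OF M] separated_def)
qed

lemma K2_critical_one_unique:
  assumes "K\<^bsub>2\<^esub> (with_proj G)"
  shows "pair_graph G" "tree_depth G = 2" "critical G" "one_unique G"
proof -
  have *: "finite (pverts G)" "card (pverts G) = 2"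
    "parcs G = {(u, v). (u, v) \<in> pverts G \<times> pverts G \<and> u \<noteq> v}"
    using assms unfolding complete_digraph_pair_def by blast+
  show G: "pair_graph G" by (rule pair_graphI) (use * in auto)
  obtain a b where ab: "pverts G = {a, b}" "a \<noteq> b" using *(2) by (auto simp: card_2_iff)
  have arcs: "(x, y) \<in> parcs G \<longleftrightarrow> x = a \<and> y = b \<or> x = b \<and> y = a" for x y
    using *(3) ab by auto
  have rank: "is_ranking 2 G (\<lambda>x. if x = v then 1 else 2)" if "v \<in> pverts G" for v
    using that ab by (auto simp: is_ranking_iff[OF G] separated_def)
  have "\<not> tree_depth G \<le> 1"
  proof
    assume "tree_depth G \<le> 1"
    then obtain f where "is_ranking 1 G f" using ex_ranking_iff[OF G] by blast
    then have f: "separated G f" "f a = 1" "f b = 1" using ab by (auto simp: is_ranking_iff[OF G])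
    then have "(a, b) \<in> low_arcs G f (f a)" by (simp add: arcs)
    then have "(a, b) \<in> (low_arcs G f (f a))\<^sup>*" by blast
    then have "a = b" using separatedD[OF f(1), of a b] f(2,3) ab by simp
    then show False using ab by simp
  qed
  moreover have "tree_depth G \<le> 2" using tree_depth_le[OF rank] ab by blast
  ultimately show td: "tree_depth G = 2" by simp
  show "critical G"
    unfolding critical_iff[OF G] td
  proof (intro allI impI)
    fix M assume M: "minor_step G M"
    have "(x, y) \<notin> parcs M" for x y
      using M
    proof cases
      case (contr_edge u v)
      then show ?thesis using arcs ab(2) unfolding contr_edge(1) parcs_contract_edge by auto
    qed (use arcs ab in auto)
    then have "tree_depth M \<le> 1" using tree_depth_edgeless pair_graph_minor_step[OF M G] by blast
    then show "tree_depth M < 2" by simp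
  qed
  have "{u \<in> pverts G. (if u = v then 1 else 2 :: nat) = 1} = {v}" if "v \<in> pverts G" for v
    using that by auto
  then show "one_unique G" unfolding one_unique_def optimal_ranking_def td using rank by blast
qed

lemma in_S_critical_one_unique_card:
  fixes \<F> :: "'a pair_pre_digraph set"
  assumes F: "\<And>F. F \<in> \<F> \<Longrightarrow> pair_graph F" "\<And>F. F \<in> \<F> \<Longrightarrow> one_unique F"
    and "in_S \<F> k G"
  shows "pair_graph G \<and> critical G \<and> tree_depth G = k \<and> one_unique G \<and>
    ((\<forall>F\<in>\<F>. card (pverts F) \<le> 2 ^ (tree_depth F - 1)) \<longrightarrow> card (pverts G) \<le> 2 ^ (k - 1))"
  using assms(3)
proof (induction rule: in_S.induct)
  case (K2 G)
  then have "card (pverts G) = 2" by (simp add: complete_digraph_pair_def)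
  then show ?case using K2_critical_one_unique[OF K2] by simp
next
  case (family k F G)
  then have F': "pair_graph F" "critical F" "tree_depth F = k" "one_unique F"
    using F by (auto simp: k_critical_def)
  then show ?case using iso_invariance[OF F'(1) family(4)] family(2) by auto
next
  case (adjoining r s k H L w G)
  interpret adjunction H L w r s
  proof (rule adjunction.intro)
    show "pair_graph H" "critical H" "one_unique H" "tree_depth H = s"
      using adjoining.IH(1) by blast+
    show "pair_graph (L v)" "critical (L v)" "one_unique (L v)" "tree_depth (L v) = r + 1"
      "w v \<in> pverts (L v)" if "v \<in> pverts H" for v
      using adjoining.IH(2)[OF that] adjoining.hyps(6)[OF that] by blast+
  qed
  have s: "s \<ge> 1" using adjoining by simp
  note iso = iso_invariance[OF pair_graph_adjoin adjoining(7)]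
  have "card (pverts G) \<le> 2 ^ (k - 1)" if bd: "\<forall>F\<in>\<F>. card (pverts F) \<le> 2 ^ (tree_depth F - 1)"
  proof -
    have "card (pverts G) = (\<Sum>v\<in>pverts H. card (pverts (L v)))"
      using pair_graphD(1)[OF H(1)] pair_graphD(1)[OF L(1)] by (simp add: iso(3) adjoin_def)
    also have "\<dots> \<le> (\<Sum>v\<in>pverts H. 2 ^ r)"
      using adjoining.IH(2) bd by (intro sum_mono) simp
    also have "\<dots> = card (pverts H) * 2 ^ r" by simp
    also have "\<dots> \<le> 2 ^ (s - 1) * 2 ^ r" using adjoining.IH(1) bd by simp
    also have "\<dots> = 2 ^ (k - 1)" using s adjoining.hyps(3) by (simp flip: power_add add: add.commute)
    finally show ?thesis .
  qed
  then show ?case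
    using iso(1,2) iso(4)[OF critical_adjoin[OF s]] iso(5)[OF one_unique_adjoin[OF s]]
      tree_depth_adjoin[OF s] adjoining.hyps(3) by auto
qed

theorem mainTheorem3:
  fixes \<F> :: "'a pair_pre_digraph set"
  assumes graphs: "\<And>F. F \<in> \<F> \<Longrightarrow> pair_graph F"
    and critical: "\<And>F. F \<in> \<F> \<Longrightarrow> critical F"
    and one_unique: "\<And>F. F \<in> \<F> \<Longrightarrow> one_unique F"
  shows "(\<forall>k\<ge>2. \<forall>G. in_S \<F> k G \<longrightarrow> pair_graph G \<and> k_critical k G \<and> one_unique G) \<and>
    ((\<forall>F\<in>\<F>. card (pverts F) \<le> 2 ^ (tree_depth F - 1)) \<longrightarrow>
     (\<forall>k\<ge>2. \<forall>G. in_S \<F> k G \<longrightarrow> card (pverts G) \<le> 2 ^ (k - 1)))"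
  using in_S_critical_one_unique_card[OF graphs one_unique] unfolding k_critical_def by blast

end
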